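(* Let $\mathbb{F}_q$ be a finite field of odd characteristic, let $n$ be an odd prime, let $a,d\in\mathbb{F}_q\setminus\{0\}$ with $a\neq d$, let $E_{a,d}: ax^2+y^2=1+dx^2y^2$, and let $\mathcal{R}:\mathcal{T}_n\to\mathbb{F}_q^{n-1}\times\{0,1\}$ be the representation of the trace zero subgroup $\mathcal{T}_n\subset E_{a,d}(\mathbb{F}_{q^n})$ by coefficients of the polynomials $q_P$, as defined in the context. Let $P\in\mathcal{T}_n$ and write $\mathcal{R}(P)=(\alpha_1,\dots,\alpha_{n-1},b)$. Then: (i) The points of $\mathcal{T}_n$ whose image under $\mathcal{R}$ is $(\alpha_1,\dots,\alpha_{n-1},b)$ are exactly the Frobenius conjugates $P,\varphi(P),\dots,\varphi^{n-1}(P)$. (ii) The following decompression procedure correctly recovers $P$ from $(\alpha_1,\dots,\alpha_{n-1},b)$ up to Frobenius conjugates. Set $$\hat{q}_1(y)=\alpha_{\frac{n-1}{2}}y^{\frac{n-3}{2}}+\dots+\alpha_2y+\alpha_1,\qquad q_2(y)=by^{\frac{n-1}{2}}+\alpha_{n-1}y^{\frac{n-3}{2}}+\dots+\alpha_{\frac{n+3}{2}}y+\alpha_{\frac{n+1}{2}},$$ $$Q_P(y)=(a-dy^2)(1+y)\hat{q}_1(y)^2+(y-1)q_2(y)^2,$$ let $v$ be any root of $Q_P$, and let $u=0$ if $v=1$ and $u=-\frac{\hat{q}_1(v)(v+1)}{q_2(v)}$ if $v\neq 1$. Then $u$ is well defined (that is, $q_2(v)\neq 0$ when $v\neq 1$),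 and $(u,v)\in\{P,\varphi(P),\dots,\varphi^{n-1}(P)\}$.
   Context: The curve $E_{a,d}$ has geometric genus one; its projective closure in $\mathbb{P}^2$ has exactly two points at infinity, $\Omega_1=[1,0,0]$ and $\Omega_2=[0,1,0]$, which are ordinary double points, and it is birationally equivalent to a smooth elliptic curve. Via this equivalence the points of $E_{a,d}$ carry a group law (the twisted Edwards addition law) with neutral element $\mathcal{O}=(0,1)$, given by $$(x_1,y_1)+(x_2,y_2)=\left(\frac{x_1y_2+x_2y_1}{1+dx_1x_2y_1y_2},\frac{y_1y_2-ax_1x_2}{1-dx_1x_2y_1y_2}\right)$$ wherever these expressions are defined; $-(x,y)=(-x,y)$. Put $\mathcal{O}'=(0,-1)\in E_{a,d}$. The Frobenius endomorphism is $\varphi(x,y)=(x^q,y^q)$. The trace zero subgroup $\mathcal{T}_n$ is the kernel of the trace map $E_{a,d}(\mathbb{F}_{q^n})\to E_{a,d}(\mathbb{F}_q)$, $P\mapsto P+\varphi(P)+\cdots+\varphi^{n-1}(P)$ (sum in the group). For a rational function $h$ on $E_{a,d}$, $\operatorname{div}(h)$ denotes the divisor of the associated homogeneous rational function on the projective closure of $E_{a,d}$: the coefficient at a point $Q$ is the sum of the orders of $h$ at the points of the normalization lying above $Q$. For example $\operatorname{div}(x)=\mathcal{O}+\mathcal{O}'-2\Omega_1$ and $\operatorname{div}(1-y)=2\mathcal{O}-2\Omega_2$. Definition of $\mathcal{R}$. For every $P\in\mathcal{T}_n$ there is a polynomial, unique up to a nonzero constant factor in $\mathbb{F}_q$, of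 the form $$q_P(x,y)=(1+y)\left(a_{\frac{n-3}{2}}y^{\frac{n-3}{2}}+\dots+a_1y+a_0\right)+x\left(b_{\frac{n-1}{2}}y^{\frac{n-1}{2}}+\dots+b_1y+b_0\right)$$ with all $a_i,b_j\in\mathbb{F}_q$ and $$\operatorname{div}(q_P)=P+\varphi(P)+\ldots+\varphi^{n-1}(P)+\mathcal{O}'-2\Omega_1-(n-1)\Omega_2$$ (formal sum of points). It is normalized by a constant so that $b_{\frac{n-1}{2}}\in\{0,1\}$; when $b_{\frac{n-1}{2}}=0$, any fixed choice of scalar multiple depending only on the class of $q_P$ up to nonzero constants is allowed. Then $$\mathcal{R}(P)=\left(a_0,\dots,a_{\frac{n-3}{2}},b_0,\dots,b_{\frac{n-3}{2}},b_{\frac{n-1}{2}}\right)\in\mathbb{F}_q^{n-1}\times\{0,1\}.$$ *)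

theory Defs
  imports
    "HOL-Algebra.Algebraic_Closure_Type"
    "HOL-Computational_Algebra.Formal_Laurent_Series"
    "HOL-Library.Cardinality"
begin

text \<open>
  The closure of the affine curve \<open>a x\<^sup>2 + y\<^sup>2 = 1 + d x\<^sup>2 y\<^sup>2\<close> in \<open>P\<^sup>1 \<times> P\<^sup>1\<close> is smooth
  (for \<open>a \<noteq> 0\<close>, \<open>d \<noteq> 0\<close>, \<open>a \<noteq> d\<close> in odd characteristic), so it is the normalization of the
  closure in \<open>P\<^sup>2\<close>.  The group law, the trace zero subgroup and orders of functions live on
  this smooth model; divisors are pushed forward to the closure in \<open>P\<^sup>2\<close>.
\<close>

datatype 'k p1 = Fin 'k | Infty

fun p1_num :: "'k::zero_neq_one p1 \<Rightarrow> 'k" where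
  "p1_num (Fin x) = x"
| "p1_num Infty = 1"

fun p1_den :: "'k::zero_neq_one p1 \<Rightarrow> 'k" where
  "p1_den (Fin x) = 1"
| "p1_den Infty = 0"

definition p1_of :: "'k::field \<Rightarrow> 'k \<Rightarrow> 'k p1" where
  "p1_of u w = (if w = 0 then Infty else Fin (u / w))"

type_synonym 'k point = "'k p1 \<times> 'k p1"

definition edwards :: "'k::field \<Rightarrow> 'k \<Rightarrow> 'k point set" where
  "edwards a d = {(x, y).
     a * p1_num x ^ 2 * p1_den y ^ 2 + p1_num y ^ 2 * p1_den x ^ 2
     = p1_den x ^ 2 * p1_den y ^ 2 + d * p1_num x ^ 2 * p1_num y ^ 2}"

text \<open>
  The complete addition law of Bernstein and Lange on \<open>P\<^sup>1 \<times> P\<^sup>1\<close>.  The first formula is the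
  homogeneous form of the twisted Edwards addition law; where it yields \<open>(0 : 0)\<close> in one of
  the two coordinates, the second (dual) formula applies.  The two agree where both apply.
\<close>

definition edwards_add :: "'k::field \<Rightarrow> 'k \<Rightarrow> 'k point \<Rightarrow> 'k point \<Rightarrow> 'k point" where
  "edwards_add a d P Q =
    (let X1 = p1_num (fst P); Z1 = p1_den (fst P); Y1 = p1_num (snd P); T1 = p1_den (snd P);
         X2 = p1_num (fst Q); Z2 = p1_den (fst Q); Y2 = p1_num (snd Q); T2 = p1_den (snd Q);
         X3 = X1 * Y2 * Z2 * T1 + X2 * Y1 * Z1 * T2;
         Z3 = Z1 * Z2 * T1 * T2 + d * X1 * X2 * Y1 * Y2;
         Y3 = Y1 * Y2 * Z1 * Z2 - a * X1 * X2 * T1 * T2;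
         T3 = Z1 * Z2 * T1 * T2 - d * X1 * X2 * Y1 * Y2;
         X3' = X1 * Y1 * Z2 * T2 + X2 * Y2 * Z1 * T1;
         Z3' = a * X1 * X2 * T1 * T2 + Y1 * Y2 * Z1 * Z2;
         Y3' = X1 * Y1 * Z2 * T2 - X2 * Y2 * Z1 * T1;
         T3' = X1 * Y2 * Z2 * T1 - X2 * Y1 * Z1 * T2
     in if (X3, Z3) \<noteq> (0, 0) \<and> (Y3, T3) \<noteq> (0, 0)
        then (p1_of X3 Z3, p1_of Y3 T3)
        else (p1_of X3' Z3', p1_of Y3' T3'))"

definition edwards_zero :: "'k::field point" where
  "edwards_zero = (Fin 0, Fin 1)"

text \<open>
  Throughout, \<open>F\<^sub>q\<close> is a finite field type \<open>'q\<close>, its extensions lie in the algebraic closure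
  \<open>'q alg_closure\<close>, and the field with \<open>q\<^sup>n\<close> elements is the fixed field of \<open>z \<mapsto> z\<^bsup>q^n\<^esup>\<close>.
\<close>

definition frob :: "'q::{field,finite} alg_closure point \<Rightarrow> 'q alg_closure point" where
  "frob = map_prod (map_p1 (\<lambda>z. z ^ CARD('q))) (map_p1 (\<lambda>z. z ^ CARD('q)))"

definition rational_points ::
  "nat \<Rightarrow> 'q::{field,finite} \<Rightarrow> 'q \<Rightarrow> 'q alg_closure point set" where
  "rational_points n a d =
     {P \<in> edwards (to_ac a) (to_ac d).
        set_p1 (fst P) \<union> set_p1 (snd P) \<subseteq> {z. z ^ (CARD('q) ^ n) = z}}"

primrec edwards_trace ::
  "nat \<Rightarrow> 'q::{field,finite} \<Rightarrow> 'q \<Rightarrow> 'q alg_closure point \<Rightarrow> 'q alg_closure point" where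
  "edwards_trace 0 a d P = edwards_zero"
| "edwards_trace (Suc m) a d P =
     edwards_add (to_ac a) (to_ac d) (edwards_trace m a d P) ((frob ^^ m) P)"

definition trace_zero ::
  "nat \<Rightarrow> 'q::{field,finite} \<Rightarrow> 'q \<Rightarrow> 'q alg_closure point set" where
  "trace_zero n a d = {P \<in> rational_points n a d. edwards_trace n a d P = edwards_zero}"

text \<open>
  The order of a function at a point of the smooth model is computed along a local
  parametrization of the curve by Laurent series \<open>(\<xi>, \<eta>)\<close>, centred at the point and such that
  one of the two local coordinates (\<open>x - x\<^sub>0\<close> or \<open>1/x\<close>, and \<open>y - y\<^sub>0\<close> or \<open>1/y\<close>) has order one.
  All such parametrizations arise from each other by substituting a series of order one, so
  the order does not depend on the choice.
\<close>

definition fls_center :: "'k::field fls \<Rightarrow> 'k p1" where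
  "fls_center \<xi> = (if fls_subdegree \<xi> < 0 then Infty else Fin (fls_nth \<xi> 0))"

definition fls_local_coord :: "'k::field fls \<Rightarrow> 'k fls" where
  "fls_local_coord \<xi> =
     (if fls_subdegree \<xi> < 0 then inverse \<xi> else \<xi> - fls_const (fls_nth \<xi> 0))"

definition local_param :: "'k::field \<Rightarrow> 'k \<Rightarrow> 'k point \<Rightarrow> 'k fls \<times> 'k fls \<Rightarrow> bool" where
  "local_param a d P p \<longleftrightarrow>
     (let \<xi> = fst p; \<eta> = snd p in
        fls_const a * \<xi> ^ 2 + \<eta> ^ 2 = 1 + fls_const d * \<xi> ^ 2 * \<eta> ^ 2 \<and>
        (fls_center \<xi>, fls_center \<eta>) = P \<and>
        (fls_subdegree (fls_local_coord \<xi>) = 1 \<or> fls_subdegree (fls_local_coord \<eta>) = 1))"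

text \<open>Bivariate polynomials are polynomials in \<open>x\<close> with coefficients polynomials in \<open>y\<close>.\<close>

definition subst_fls :: "'k::field poly poly \<Rightarrow> 'k fls \<times> 'k fls \<Rightarrow> 'k fls" where
  "subst_fls f XY =
     poly (map_poly (\<lambda>p. poly (map_poly fls_const p) (snd XY)) f) (fst XY)"

text \<open>Meaningful only for \<open>f\<close> not vanishing identically on the curve.\<close>

definition ord_at :: "'k::field \<Rightarrow> 'k \<Rightarrow> 'k poly poly \<Rightarrow> 'k point \<Rightarrow> int" where
  "ord_at a d f P = fls_subdegree (subst_fls f (SOME XY. local_param a d P XY))"

text \<open>
  Points of the closure in \<open>P\<^sup>2\<close>: \<open>Affine x y\<close> is \<open>[x, y, 1]\<close>, \<open>Omega1\<close> is \<open>[1, 0, 0]\<close> and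
  \<open>Omega2\<close> is \<open>[0, 1, 0]\<close>.  No point of the curve has both coordinates infinite.
\<close>

datatype 'k plane_point = Affine 'k 'k | Omega1 | Omega2

fun to_plane :: "'k point \<Rightarrow> 'k plane_point" where
  "to_plane (Fin x, Fin y) = Affine x y"
| "to_plane (Infty, y) = Omega1"
| "to_plane (Fin x, Infty) = Omega2"

definition divisor :: "'k::field \<Rightarrow> 'k \<Rightarrow> 'k poly poly \<Rightarrow> 'k plane_point \<Rightarrow> int" where
  "divisor a d f Q = (\<Sum>P | P \<in> edwards a d \<and> to_plane P = Q. ord_at a d f P)"

definition single_point :: "'k plane_point \<Rightarrow> 'k plane_point \<Rightarrow> int" where
  "single_point P Q = (if Q = P then 1 else 0)"

text \<open>
  \<open>qpoly as bs\<close> is \<open>(1 + y) (\<dots> + a\<^sub>1 y + a\<^sub>0) + x (\<dots> + b\<^sub>1 y + b\<^sub>0)\<close>; coefficient lists start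
  with the constant term.
\<close>

definition qpoly :: "'q::field list \<Rightarrow> 'q list \<Rightarrow> 'q alg_closure poly poly" where
  "qpoly as bs = [: [:1, 1:] * map_poly to_ac (Poly as), map_poly to_ac (Poly bs) :]"

definition is_qpoly ::
  "nat \<Rightarrow> 'q::{field,finite} \<Rightarrow> 'q \<Rightarrow> 'q alg_closure point \<Rightarrow> 'q list \<Rightarrow> 'q list \<Rightarrow> bool" where
  "is_qpoly n a d P as bs \<longleftrightarrow>
     length as = (n - 1) div 2 \<and> length bs = (n + 1) div 2 \<and> qpoly as bs \<noteq> 0 \<and>
     (\<forall>Q. divisor (to_ac a) (to_ac d) (qpoly as bs) Q =
            (\<Sum>i<n. single_point (to_plane ((frob ^^ i) P)) Q)
            + single_point (Affine 0 (-1)) Q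
            - 2 * single_point Omega1 Q
            - (int n - 1) * single_point Omega2 Q)"

text \<open>
  \<open>R\<close> is determined by its defining properties only up to the choice of scalar multiple in
  the case \<open>b = 0\<close>; the second conjunct says that this choice depends only on the class of
  the polynomial up to nonzero constants.
\<close>

definition is_representation ::
  "nat \<Rightarrow> 'q::{field,finite} \<Rightarrow> 'q \<Rightarrow> ('q alg_closure point \<Rightarrow> 'q list \<times> 'q) \<Rightarrow> bool" where
  "is_representation n a d R \<longleftrightarrow>
     (\<forall>P\<in>trace_zero n a d. \<exists>as bs. is_qpoly n a d P as bs \<and> last bs \<in> {0, 1} \<and>
        R P = (as @ butlast bs, last bs)) \<and>
     (\<forall>P\<in>trace_zero n a d. \<forall>P'\<in>trace_zero n a d. \<forall>c. c \<noteq> 0 \<longrightarrow>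
        R P' = (map ((*) c) (fst (R P)), c * snd (R P)) \<longrightarrow> R P' = R P)"

text \<open>
  The polynomials of the decompression procedure; \<open>\<alpha>\<^sub>i\<close> is \<open>\<alpha> ! (i - 1)\<close>.
\<close>

definition dec_q1 :: "nat \<Rightarrow> 'q::field list \<Rightarrow> 'q poly" where
  "dec_q1 n \<alpha> = Poly (take ((n - 1) div 2) \<alpha>)"

definition dec_q2 :: "nat \<Rightarrow> 'q::field list \<Rightarrow> 'q \<Rightarrow> 'q poly" where
  "dec_q2 n \<alpha> b = Poly (drop ((n - 1) div 2) \<alpha> @ [b])"

definition dec_Q :: "nat \<Rightarrow> 'q::field \<Rightarrow> 'q \<Rightarrow> 'q list \<Rightarrow> 'q \<Rightarrow> 'q poly" where
  "dec_Q n a d \<alpha> b =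
     [:a, 0, - d:] * [:1, 1:] * dec_q1 n \<alpha> ^ 2 + [:- 1, 1:] * dec_q2 n \<alpha> b ^ 2"

end

theory Submission
  imports Defs
begin

text \<open>
  The product \<open>q\<^sub>P(x, y) q\<^sub>P(-x, y)\<close> equals \<open>(1 + y) Q\<^sub>P(y) / (a - d y\<^sup>2)\<close> on the curve, so above a root
  \<open>v \<noteq> 1\<close> of \<open>Q\<^sub>P\<close> the point with \<open>q\<^sub>1(v) (1 + v) + u q\<^sub>2(v) = 0\<close> is a zero of \<open>q\<^sub>P\<close>, hence a conjugate
  of \<open>P\<close>.  For \<open>q\<^sub>2(v) \<noteq> 0\<close> one uses the exact orders of \<open>q\<^sub>P\<close> at \<open>(0, -1)\<close> and over \<open>\<Omega>\<^sub>1\<close>, and that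
  \<open>(u, v)\<close> and \<open>(-u, v)\<close> are not conjugate because \<open>n\<close> is odd.

  The divisor determines the conjugates.  Conversely, that conjugates have proportional polynomials
  needs no comparison of multiplicities: either \<open>P\<close> is fixed by Frobenius and there is nothing to
  show, or, \<open>n\<close> being prime, \<open>P\<close> has \<open>n\<close> distinct conjugates and counting them suffices.  Of the
  group law only the multiples of a few explicit points of order two and four are used, which shows
  that all points of trace zero are affine and different from \<open>(0, -1)\<close>.
\<close>

section \<open>Polynomials under coefficient maps, and the Bezout identity\<close>

lemma map_poly_hom_add:
  assumes "h 0 = 0" "\<And>x y. h (x + y) = h x + h y"
  shows "map_poly h (p + q) = map_poly h p + map_poly h q"
  by (rule poly_eqI) (simp add: coeff_map_poly assms)

lemma map_poly_hom_mult:
  fixes h :: "'a::comm_semiring_1 \<Rightarrow> 'b::comm_semiring_1"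
  assumes "h 0 = 0" "\<And>x y. h (x + y) = h x + h y" "\<And>x y. h (x * y) = h x * h y"
  shows "map_poly h (p * q) = map_poly h p * map_poly h q"
proof (rule poly_eqI)
  have sum: "h (sum f A) = (\<Sum>i\<in>A. h (f i))" if "finite A" for f and A :: "nat set"
    using that by (induction A) (simp_all add: assms)
  show "coeff (map_poly h (p * q)) i = coeff (map_poly h p * map_poly h q) i" for i
    by (simp add: coeff_map_poly coeff_mult assms sum)
qed

text \<open>Euclid's algorithm over an arbitrary field. The measure separates \<open>q = 0\<close>
  from nonzero constants, so passing to \<open>p mod q\<close> always decreases it.\<close>

lemma poly_bezout:
  fixes p q :: "'a::field poly"
  shows "\<exists>g s t. g = s * p + t * q \<and> g dvd p \<and> g dvd q"
proof (induction q arbitrary: p rule: measure_induct_rule[where f = "\<lambda>q. if q = 0 then 0 else Suc (degree q)"])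
  case (less q)
  show ?case
  proof (cases "q = 0")
    case True
    then show ?thesis by (intro exI[of _ p] exI[of _ 1] exI[of _ 0]) simp
  next
    case False
    then have "(if p mod q = 0 then 0 else Suc (degree (p mod q))) < (if q = 0 then 0 else Suc (degree q))"
      using degree_mod_less[of q p] by auto
    from less[OF this, of q] obtain g s t
      where g: "g = s * q + t * (p mod q)" "g dvd q" "g dvd p mod q" by blast
    have "g dvd p" using g(2,3) by (metis dvd_add dvd_mult mult_div_mod_eq mult.commute)
    moreover have "g = t * p + (s - t * (p div q)) * q"
    proof -
      have "p mod q = p - (p div q) * q" by (simp add: minus_div_mult_eq_mod)
      then have "t * p + (s - t * (p div q)) * q = s * q + t * (p mod q)"
        by (simp only: ring_distribs left_diff_distrib mult.assoc) simp
      then show ?thesis using g(1) by simp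
    qed
    ultimately show ?thesis using g(2) by blast
  qed
qed

section \<open>Square roots of power series and local parametrizations\<close>

text \<open>The compositional inverse \<open>h\<close> of \<open>2 s X + X^2\<close> exists because
  \<open>2 s\<close> is nonzero, and it satisfies \<open>(s + h)^2 = s^2 + X\<close>. Substituting
  \<open>F - s^2\<close> for \<open>X\<close> gives the root.\<close>

lemma fps_square_root:
  fixes F :: "'k::field fps"
  assumes "(2::'k) \<noteq> 0" "s \<noteq> 0" "fps_nth F 0 = s ^ 2"
  obtains G where "G ^ 2 = F" "fps_nth G 0 = s"
proof -
  define g :: "'k fps" where "g = fps_const (2 * s) * fps_X + fps_X ^ 2"
  define h where "h = fps_inv g"
  have g: "fps_nth g 0 = 0" "fps_nth g 1 \<noteq> 0"
    using assms by (auto simp: g_def power2_eq_square)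
  have h0: "fps_nth h 0 = 0" by (simp add: h_def fps_inv_def)
  have F0: "fps_nth (F - fps_const (s ^ 2)) 0 = 0" using assms by simp
  have "g oo h = fps_const (2 * s) * h + h ^ 2"
    using h0 by (simp add: g_def fps_compose_add_distrib fps_compose_mult_distrib flip: fps_compose_power)
  then have h: "fps_const (2 * s) * h + h ^ 2 = fps_X"
    using fps_inv_right[OF g] by (simp add: h_def)
  define G where "G = (fps_const s + h) oo (F - fps_const (s ^ 2))"
  have "(fps_const s + h) ^ 2 = fps_const (s ^ 2) + fps_X"
    unfolding h[symmetric] by (simp add: power2_eq_square algebra_simps fps_const_mult[symmetric] numeral_fps_const del: fps_const_mult)
  then have "G ^ 2 = F"
    using F0 unfolding G_def by (subst fps_compose_power) (auto simp: fps_compose_add_distrib)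
  moreover have "fps_nth G 0 = s" using h0 by (simp add: G_def)
  ultimately show ?thesis using that by blast
qed

text \<open>Keeps values at series without pole among power series, where low coefficients are
  directly accessible; \<open>subst_fls\<close> reduces to it wherever \<open>y\<close> is
  finite.\<close>

definition eval_fps_poly :: "'k::field poly \<Rightarrow> 'k fps \<Rightarrow> 'k fps" where
  "eval_fps_poly p y = poly (map_poly fps_const p) y"

lemma eval_fps_poly_pCons [simp]:
  "eval_fps_poly 0 y = 0"
  "eval_fps_poly (pCons c p) y = fps_const c + y * eval_fps_poly p y"
  by (simp_all add: eval_fps_poly_def map_poly_pCons)

lemma eval_fps_poly_1 [simp]: "eval_fps_poly 1 y = 1"
  by (simp add: one_pCons)

lemma eval_fps_poly_add [simp]: "eval_fps_poly (p + q) y = eval_fps_poly p y + eval_fps_poly q y"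
  by (simp add: eval_fps_poly_def map_poly_hom_add)

lemma eval_fps_poly_mult [simp]: "eval_fps_poly (p * q) y = eval_fps_poly p y * eval_fps_poly q y"
  by (simp add: eval_fps_poly_def map_poly_hom_mult)

lemma eval_fps_poly_minus [simp]: "eval_fps_poly (- p) y = - eval_fps_poly p y"
  using eval_fps_poly_add[of "-p" p y] by (simp add: eq_neg_iff_add_eq_0)

lemma eval_fps_poly_diff [simp]: "eval_fps_poly (p - q) y = eval_fps_poly p y - eval_fps_poly q y"
  using eval_fps_poly_add[of p "-q" y] by simp

lemma eval_fps_poly_power [simp]: "eval_fps_poly (p ^ m) y = eval_fps_poly p y ^ m"
  by (induction m) simp_all

lemma eval_fps_poly_nth_0 [simp]: "fps_nth (eval_fps_poly p y) 0 = poly p (fps_nth y 0)"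
  by (induction p) simp_all

lemma eval_fls_poly_fps:
  "poly (map_poly fls_const p) (fps_to_fls y) = fps_to_fls (eval_fps_poly p y)"
  by (induction p) (simp_all add: map_poly_pCons fls_times_fps_to_fls)

lemma subst_fls_linear:
  "subst_fls [:A, B:] (\<xi>, fps_to_fls y) = fps_to_fls (eval_fps_poly A y) + \<xi> * fps_to_fls (eval_fps_poly B y)"
  by (simp add: subst_fls_def map_poly_pCons eval_fls_poly_fps)

text \<open>The polynomial splits into linear factors, and a product of series \<open>y - r\<close>
  vanishes only if one of them does: a nonconstant series is transcendental over the
  constants.\<close>

lemma eval_fps_poly_eq_0:
  fixes p :: "'k::alg_closed_field poly"
  assumes "eval_fps_poly p y = 0" "p \<noteq> 0"
  shows "\<exists>c. y = fps_const c"
  using assms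
proof (induction "degree p" arbitrary: p)
  case 0
  then show ?case by (auto elim!: degree_eq_zeroE)
next
  case (Suc m)
  then obtain r where "poly p r = 0"
    using alg_closed_imp_poly_has_root[of p] by auto
  then obtain p' where p: "p = [:- r, 1:] * p'"
    using poly_eq_0_iff_dvd by (metis dvdE)
  then have "p' \<noteq> 0" using Suc by auto
  then have "degree p = Suc (degree p')" unfolding p by (subst degree_mult_eq) auto
  moreover have "(y - fps_const r) * eval_fps_poly p' y = 0"
    using Suc.prems(1) unfolding p eval_fps_poly_mult by (simp add: fps_const_neg[symmetric] del: fps_const_neg)
  ultimately show ?case using Suc \<open>p' \<noteq> 0\<close> by auto
qed

lemma fls_nonneg_subdegree_fps:
  assumes "fls_subdegree f \<ge> 0"
  obtains g where "f = fps_to_fls g"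
proof
  show "f = fps_to_fls (fls_regpart f)" using assms by (intro fls_eqI) auto
qed

lemma fls_center_fps [simp]: "fls_center (fps_to_fls x) = Fin (fps_nth x 0)"
  using fls_subdegree_fls_to_fps_gt0[of x] by (simp add: fls_center_def)

lemma fls_subdegree_local_coord_fps:
  "fls_subdegree (fls_local_coord (fps_to_fls x)) = int (subdegree (x - fps_const (fps_nth x 0)))"
proof -
  have "fls_local_coord (fps_to_fls x) = fps_to_fls (x - fps_const (fps_nth x 0))"
    using fls_subdegree_fls_to_fps_gt0[of x] by (simp add: fls_local_coord_def)
  then show ?thesis by (simp only: fls_subdegree_fls_to_fps)
qed

section \<open>The smooth model: its points and their local parametrizations\<close>

locale edwards_curve =
  fixes a d :: "'k::alg_closed_field"
  assumes a_nz: "a \<noteq> 0" and d_nz: "d \<noteq> 0" and a_neq_d: "a \<noteq> d" and two_nz: "(2::'k) \<noteq> 0"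
begin

lemma minus_neq_self: "(x::'k) \<noteq> 0 \<Longrightarrow> - x \<noteq> x"
  using two_nz by (metis add.inverse_inverse mult_2 mult_eq_0_iff neg_eq_iff_add_eq_0)

lemma edwards_affine:
  "(Fin s, Fin v) \<in> edwards a d \<longleftrightarrow> s ^ 2 * (a - d * v ^ 2) = 1 - v ^ 2"
  "(Fin s, Fin v) \<in> edwards a d \<longleftrightarrow> v ^ 2 * (1 - d * s ^ 2) = 1 - a * s ^ 2"
  by (auto simp: edwards_def algebra_simps)

lemma edwards_infinite [simp]:
  "(Infty, Fin v) \<in> edwards a d \<longleftrightarrow> d * v ^ 2 = a"
  "(Fin s, Infty) \<in> edwards a d \<longleftrightarrow> d * s ^ 2 = 1"
  "(Infty, Infty) \<notin> edwards a d"
  using d_nz by (auto simp: edwards_def)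

text \<open>Where \<open>a = d v^2\<close>, the curve equation leaves \<open>v^2 = 1\<close>, hence
  \<open>a = d\<close>.\<close>

lemma edwards_affine_x_den:
  assumes "(Fin s, Fin v) \<in> edwards a d" shows "a - d * v ^ 2 \<noteq> 0"
  using assms a_neq_d unfolding edwards_affine(1) by auto

lemma local_param_fps:
  "local_param a d (Fin s, Fin v) (fps_to_fls x, fps_to_fls y) \<longleftrightarrow>
     x ^ 2 * (fps_const a - fps_const d * y ^ 2) = 1 - y ^ 2 \<and> fps_nth x 0 = s \<and> fps_nth y 0 = v \<and>
     (subdegree (x - fps_const s) = 1 \<or> subdegree (y - fps_const v) = 1)"
proof -
  have "fls_const a * fps_to_fls x ^ 2 + fps_to_fls y ^ 2 = 1 + fls_const d * fps_to_fls x ^ 2 * fps_to_fls y ^ 2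
    \<longleftrightarrow> fps_to_fls (fps_const a * x ^ 2 + y ^ 2) = fps_to_fls (1 + fps_const d * x ^ 2 * y ^ 2)"
    by (simp add: fls_times_fps_to_fls fps_to_fls_power del: fps_to_fls_eq_iff)
  also have "\<dots> \<longleftrightarrow> x ^ 2 * (fps_const a - fps_const d * y ^ 2) = 1 - y ^ 2"
    unfolding fps_to_fls_eq_iff by (auto simp: algebra_simps)
  finally show ?thesis
    by (auto simp: local_param_def fls_subdegree_local_coord_fps)
qed

lemma local_param_affineE:
  assumes "local_param a d (Fin s, Fin v) p"
  obtains x y where "p = (fps_to_fls x, fps_to_fls y)"
    "x ^ 2 * (fps_const a - fps_const d * y ^ 2) = 1 - y ^ 2" "fps_nth x 0 = s" "fps_nth y 0 = v"
    "subdegree (x - fps_const s) = 1 \<or> subdegree (y - fps_const v) = 1"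
proof -
  have "fls_center (fst p) = Fin s" "fls_center (snd p) = Fin v"
    using assms by (auto simp: local_param_def Let_def)
  then have "fls_subdegree (fst p) \<ge> 0" "fls_subdegree (snd p) \<ge> 0"
    by (auto simp: fls_center_def split: if_splits)
  then obtain x y where "p = (fps_to_fls x, fps_to_fls y)"
    by (metis fls_nonneg_subdegree_fps prod.collapse)
  with assms that show ?thesis by (auto simp: local_param_fps)
qed

text \<open>Justifies the choice made in \<open>ord_at\<close>. One local coordinate is taken as the
  variable; the square of the other coordinate is then a series with nonzero square constant term,
  so \<open>fps_square_root\<close> applies.\<close>

lemma local_param_exists:
  assumes "P \<in> edwards a d"
  shows "\<exists>p. local_param a d P p"
proof -
  \<comment> \<open>Used with \<open>Z = 1/x\<close> or \<open>Z = 1/y\<close> to return from the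
    equation without denominators to the curve equation.\<close>
  have clear: "\<alpha> * inverse Z ^ 2 + \<beta> = \<gamma> + \<delta> * inverse Z ^ 2"
    if "\<alpha> + \<beta> * Z ^ 2 = \<gamma> * Z ^ 2 + \<delta>" "Z \<noteq> 0" for \<alpha> \<beta> \<gamma> \<delta> Z :: "'k fls"
    using that by (simp add: field_simps)
  have inv_X: "fls_center (inverse fls_X :: 'k fls) = Infty"
    "fls_subdegree (fls_local_coord (inverse fls_X :: 'k fls)) = 1"
    by (simp_all add: fls_center_def fls_local_coord_def)
  have lin: "subdegree (fps_const c + fps_X - fps_const c) = 1" for c :: 'k by simp
  consider s v where "P = (Fin s, Fin v)" "s \<noteq> 0" | v where "P = (Fin 0, Fin v)"
    | v where "P = (Infty, Fin v)" | s where "P = (Fin s, Infty)"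
    using assms by (cases P; cases "fst P"; cases "snd P") auto
  then show ?thesis
  proof cases
    case 1
    define y where "y = fps_const v + fps_X"
    define D where "D = fps_const a - fps_const d * y ^ 2"
    have D0: "fps_nth D 0 = a - d * v ^ 2" by (simp add: D_def y_def power2_eq_square)
    have D: "fps_nth D 0 \<noteq> 0" using edwards_affine_x_den assms 1 D0 by simp
    have "s ^ 2 * (a - d * v ^ 2) = 1 - v ^ 2" using assms 1 by (simp add: edwards_affine(1))
    then have "fps_nth ((1 - y ^ 2) * inverse D) 0 = s ^ 2"
      using D by (simp add: D0 y_def field_simps power2_eq_square)
    then obtain x where x: "x ^ 2 = (1 - y ^ 2) * inverse D" "fps_nth x 0 = s"
      using fps_square_root two_nz 1(2) by metis
    have "x ^ 2 * D = 1 - y ^ 2"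
      unfolding x(1) using D by (simp add: mult.assoc inverse_mult_eq_1)
    then have "local_param a d P (fps_to_fls x, fps_to_fls y)"
      unfolding 1(1) local_param_fps using x lin[of v] by (simp add: D_def y_def)
    then show ?thesis by blast
  next
    case 2
    define D where "D = 1 - fps_const d * fps_X ^ 2"
    have D: "fps_nth D 0 = 1" by (simp add: D_def)
    have v: "v ^ 2 = 1" using assms 2 by (simp add: edwards_affine(1))
    have "fps_nth ((1 - fps_const a * fps_X ^ 2) * inverse D) 0 = v ^ 2" using v D by simp
    moreover have "v \<noteq> 0" using v by auto
    ultimately obtain y where y: "y ^ 2 = (1 - fps_const a * fps_X ^ 2) * inverse D" "fps_nth y 0 = v"
      using fps_square_root two_nz by metis
    have "y ^ 2 * D = 1 - fps_const a * fps_X ^ 2"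
      unfolding y(1) using D by (simp add: mult.assoc inverse_mult_eq_1)
    then have "fps_X ^ 2 * (fps_const a - fps_const d * y ^ 2) = 1 - y ^ 2"
      by (simp add: D_def algebra_simps)
    then have "local_param a d P (fps_to_fls fps_X, fps_to_fls y)"
      unfolding 2(1) local_param_fps using y by simp
    then show ?thesis by blast
  next
    case 3
    define D where "D = fps_X ^ 2 - fps_const d"
    have D: "fps_nth D 0 = - d" by (simp add: D_def)
    have v: "d * v ^ 2 = a" using assms 3 by simp
    then have "fps_nth ((fps_X ^ 2 - fps_const a) * inverse D) 0 = v ^ 2" using D d_nz by (simp add: field_simps)
    moreover have "v \<noteq> 0" using v a_nz by auto
    ultimately obtain y where y: "y ^ 2 = (fps_X ^ 2 - fps_const a) * inverse D" "fps_nth y 0 = v"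
      using fps_square_root two_nz by metis
    have "y ^ 2 * D = fps_X ^ 2 - fps_const a"
      unfolding y(1) using D d_nz by (simp add: mult.assoc inverse_mult_eq_1)
    then have "fps_const a + y ^ 2 * fps_X ^ 2 = fps_X ^ 2 + fps_const d * y ^ 2"
      by (simp add: D_def algebra_simps)
    then have "fps_to_fls (fps_const a + y ^ 2 * fps_X ^ 2) = fps_to_fls (fps_X ^ 2 + fps_const d * y ^ 2)"
      by simp
    then have "fls_const a + fps_to_fls y ^ 2 * fls_X ^ 2 = fls_X ^ 2 + fls_const d * fps_to_fls y ^ 2"
      by (simp add: fls_times_fps_to_fls fps_to_fls_power del: fps_to_fls_eq_iff)
    then have "fls_const a * inverse fls_X ^ 2 + fps_to_fls y ^ 2
        = 1 + fls_const d * inverse fls_X ^ 2 * fps_to_fls y ^ 2"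
      using clear[of "fls_const a" "fps_to_fls y ^ 2" fls_X 1] by (simp only: mult_ac mult_1_left) auto
    then have "local_param a d P (inverse fls_X, fps_to_fls y)"
      unfolding 3 local_param_def Let_def by (simp add: y inv_X del: fls_inverse_X)
    then show ?thesis by blast
  next
    case 4
    define D where "D = fps_const a * fps_X ^ 2 - fps_const d"
    have D: "fps_nth D 0 = - d" by (simp add: D_def)
    have s: "d * s ^ 2 = 1" using assms 4 by simp
    then have "fps_nth ((fps_X ^ 2 - 1) * inverse D) 0 = s ^ 2" using D d_nz by (simp add: field_simps)
    moreover have "s \<noteq> 0" using s by auto
    ultimately obtain x where x: "x ^ 2 = (fps_X ^ 2 - 1) * inverse D" "fps_nth x 0 = s"
      using fps_square_root two_nz by metis
    have "x ^ 2 * D = fps_X ^ 2 - 1"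
      unfolding x(1) using D d_nz by (simp add: mult.assoc inverse_mult_eq_1)
    then have "fps_const a * x ^ 2 * fps_X ^ 2 + 1 = fps_X ^ 2 + fps_const d * x ^ 2"
      by (simp add: D_def algebra_simps)
    then have "fps_to_fls (fps_const a * x ^ 2 * fps_X ^ 2 + 1) = fps_to_fls (fps_X ^ 2 + fps_const d * x ^ 2)"
      by simp
    then have "fls_const a * fps_to_fls x ^ 2 * fls_X ^ 2 + 1 = fls_X ^ 2 + fls_const d * fps_to_fls x ^ 2"
      by (simp add: fls_times_fps_to_fls fps_to_fls_power del: fps_to_fls_eq_iff)
    then have "fls_const a * fps_to_fls x ^ 2 + inverse fls_X ^ 2
        = 1 + fls_const d * fps_to_fls x ^ 2 * inverse fls_X ^ 2"
      using clear[of 1 "fls_const a * fps_to_fls x ^ 2" fls_X 1] by (simp only: add.commute mult_1_left) auto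
    then have "local_param a d P (fps_to_fls x, inverse fls_X)"
      unfolding 4 local_param_def Let_def by (simp add: x inv_X del: fls_inverse_X)
    then show ?thesis by blast
  qed
qed

section \<open>Orders of the functions \<open>A(y) + x B(y)\<close>\<close>

text \<open>The parametrization chosen in \<open>ord_at\<close> depends only on the point, so a
  single \<open>p\<close> serves all functions.\<close>

lemma ord_atE:
  assumes "P \<in> edwards a d"
  obtains p where "local_param a d P p" "\<And>f. ord_at a d f P = fls_subdegree (subst_fls f p)"
  using someI_ex[OF local_param_exists[OF assms]] by (auto simp: ord_at_def)

lemma ord_at_affineE:
  assumes "(Fin s, Fin v) \<in> edwards a d"
  obtains x y where
    "x ^ 2 * (fps_const a - fps_const d * y ^ 2) = 1 - y ^ 2" "fps_nth x 0 = s" "fps_nth y 0 = v"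
    "subdegree (x - fps_const s) = 1 \<or> subdegree (y - fps_const v) = 1"
    "\<And>A B. ord_at a d [:A, B:] (Fin s, Fin v) = subdegree (eval_fps_poly A y + x * eval_fps_poly B y)"
proof -
  obtain p where p: "local_param a d (Fin s, Fin v) p"
      "\<And>f. ord_at a d f (Fin s, Fin v) = fls_subdegree (subst_fls f p)"
    using ord_atE[OF assms] by blast
  show ?thesis
  proof (rule local_param_affineE[OF p(1)], rule that)
    show "ord_at a d [:A, B:] (Fin s, Fin v) = subdegree (eval_fps_poly A y + x * eval_fps_poly B y)"
      if "p = (fps_to_fls x, fps_to_fls y)" for A B x y
      unfolding p that subst_fls_linear
      by (simp add: fls_subdegree_fls_to_fps flip: fls_times_fps_to_fls fps_to_fls_plus)
  qed
qed

lemma ord_at_pos_imp_root: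
  assumes "(Fin s, Fin v) \<in> edwards a d" "ord_at a d [:A, B:] (Fin s, Fin v) > 0"
  shows "poly A v + s * poly B v = 0"
proof -
  obtain x y where xy: "fps_nth x 0 = s" "fps_nth y 0 = v"
    "\<And>A B. ord_at a d [:A, B:] (Fin s, Fin v) = subdegree (eval_fps_poly A y + x * eval_fps_poly B y)"
    by (rule ord_at_affineE[OF assms(1)]) blast
  have "fps_nth (eval_fps_poly A y + x * eval_fps_poly B y) 0 = 0"
    using assms(2) unfolding xy(3) by (intro nth_less_subdegree_zero) auto
  then show ?thesis using xy by simp
qed

text \<open>The constant term vanishes, but the zero series has subdegree 0 and must be excluded. If
  \<open>A + x B\<close> were zero along the parametrization, so would be its norm under
  \<open>x \<mapsto> -x\<close>, cleared of the denominator \<open>a - d y^2\<close>. This makes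
  \<open>y\<close> constant and \<open>x\<close> a series of nonzero linear term with constant
  square, which is absurd.\<close>

lemma root_imp_ord_at_pos:
  assumes P: "(Fin s, Fin v) \<in> edwards a d" and root: "poly A v + s * poly B v = 0"
    and norm: "[:a, 0, - d:] * A ^ 2 - [:1, 0, - 1:] * B ^ 2 \<noteq> 0"
  shows "ord_at a d [:A, B:] (Fin s, Fin v) > 0"
proof -
  obtain x y where curve: "x ^ 2 * (fps_const a - fps_const d * y ^ 2) = 1 - y ^ 2"
    and xy: "fps_nth x 0 = s" "fps_nth y 0 = v"
    and unif: "subdegree (x - fps_const s) = 1 \<or> subdegree (y - fps_const v) = 1"
    and ord: "\<And>A B. ord_at a d [:A, B:] (Fin s, Fin v) = subdegree (eval_fps_poly A y + x * eval_fps_poly B y)"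
    by (rule ord_at_affineE[OF P]) blast
  let ?A = "eval_fps_poly A y" and ?B = "eval_fps_poly B y"
  have "fps_nth (?A + x * ?B) 0 = 0" using root xy by simp
  moreover have "?A + x * ?B \<noteq> 0"
  proof
    assume "?A + x * ?B = 0"
    then have "?A = - (x * ?B)" by (simp add: eq_neg_iff_add_eq_0)
    then have "(fps_const a - fps_const d * y ^ 2) * ?A ^ 2
        = x ^ 2 * (fps_const a - fps_const d * y ^ 2) * ?B ^ 2"
      by (simp only: power2_minus power_mult_distrib mult_ac)
    then have "(fps_const a - fps_const d * y ^ 2) * ?A ^ 2 = (1 - y ^ 2) * ?B ^ 2"
      by (simp only: curve)
    then have "eval_fps_poly ([:a, 0, - d:] * A ^ 2 - [:1, 0, - 1:] * B ^ 2) y = 0"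
      unfolding eval_fps_poly_diff eval_fps_poly_mult eval_fps_poly_power
      by (simp add: power2_eq_square algebra_simps fps_const_neg[symmetric] del: fps_const_neg)
    then obtain c where "y = fps_const c"
      using eval_fps_poly_eq_0 norm by blast
    with xy have y: "y = fps_const v" by simp
    define e where "e = a - d * v ^ 2"
    have e: "e \<noteq> 0" using edwards_affine_x_den P by (simp add: e_def)
    have x1: "fps_nth x 1 \<noteq> 0"
    proof -
      have "subdegree (x - fps_const s) = 1" using unif by (simp add: y)
      then have "fps_nth (x - fps_const s) 1 \<noteq> 0"
        by (metis nth_subdegree_nonzero subdegree_0 zero_neq_one)
      then show ?thesis by simp
    qed
    have "x ^ 2 * fps_const e = fps_const (1 - v ^ 2)"
      using curve unfolding y e_def
      by (simp add: fps_const_sub[symmetric] del: fps_const_sub)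
    then have x2: "x ^ 2 = fps_const ((1 - v ^ 2) / e)"
    proof -
      have "x ^ 2 = x ^ 2 * fps_const e * fps_const (1 / e)" using e by (simp add: mult.assoc)
      then show ?thesis using \<open>x ^ 2 * fps_const e = _\<close> by simp
    qed
    \<comment> \<open>The constant series \<open>x^2\<close> has no terms in \<open>X\<close> and
      \<open>X^2\<close>. The first forces \<open>s = 0\<close>; the second is then the square of
      the nonzero linear coefficient of \<open>x\<close>.\<close>
    have c1: "fps_nth (x ^ 2) 1 = 2 * s * fps_nth x 1"
      using xy by (simp add: power2_eq_square fps_mult_nth_1)
    then have "s = 0" using x2 x1 two_nz by auto
    then have "fps_nth (x ^ 2) 2 = fps_nth x 1 ^ 2"
      using xy by (simp add: power2_eq_square fps_mult_nth numeral_2_eq_2)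
    then show False using x2 x1 by simp
  qed
  ultimately show ?thesis unfolding ord of_nat_0_less_iff subdegree_pos_iff by blast
qed

text \<open>At \<open>(0, -1)\<close> the function \<open>1 + y\<close> vanishes to order two.\<close>

lemma ord_at_two_torsion:
  assumes "ord_at a d [:[:1, 1:] * q1, q2:] (Fin 0, Fin (- 1)) = 1"
  shows "poly q2 (- 1) \<noteq> 0"
proof
  assume q2: "poly q2 (- 1) = 0"
  have "(Fin 0, Fin (- 1)) \<in> edwards a d" by (simp add: edwards_affine(1))
  then obtain x y where curve: "x ^ 2 * (fps_const a - fps_const d * y ^ 2) = 1 - y ^ 2"
    and xy: "fps_nth x 0 = 0" "fps_nth y 0 = - 1"
    and ord: "\<And>A B. ord_at a d [:A, B:] (Fin 0, Fin (- 1)) = subdegree (eval_fps_poly A y + x * eval_fps_poly B y)"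
    by (rule ord_at_affineE) blast
  \<comment> \<open>Comparison at degree one: \<open>x\<close> vanishes at the point, so
    \<open>x^2\<close> contributes nothing and twice the linear coefficient of \<open>y\<close> is
    zero.\<close>
  have "fps_nth (x ^ 2 * (fps_const a - fps_const d * y ^ 2)) 1 = fps_nth (1 - y ^ 2) 1"
    by (simp only: curve)
  then have y1: "fps_nth y 1 = 0"
    using xy two_nz by (simp add: fps_mult_nth_1 power2_eq_square flip: mult_2)
  let ?F = "eval_fps_poly ([:1, 1:] * q1) y + x * eval_fps_poly q2 y"
  have "subdegree ?F = 1" using assms ord[of "[:1, 1:] * q1" q2] by simp
  then have "fps_nth ?F 1 \<noteq> 0" by (metis nth_subdegree_nonzero subdegree_0 zero_neq_one)
  moreover have "fps_nth ?F 1 = 0"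
    unfolding eval_fps_poly_mult by (simp add: fps_mult_nth_1 xy y1[simplified] q2)
  ultimately show False by simp
qed

text \<open>With \<open>z = 1/x\<close> the function is \<open>(A z + B) / z\<close>. Since
  \<open>y - v\<close> vanishes to order at least two, \<open>z\<close> must be the coordinate of
  order one, and the numerator vanishes at the point when \<open>B(v) = 0\<close>.\<close>

lemma ord_at_infinity:
  assumes v: "d * v ^ 2 = a"
  shows "ord_at a d [:A, B:] (Infty, Fin v) \<ge> - 1"
    and "poly B v = 0 \<Longrightarrow> ord_at a d [:A, B:] (Infty, Fin v) \<ge> 0"
proof -
  have v0: "v \<noteq> 0" using v a_nz by auto
  have "(Infty, Fin v) \<in> edwards a d" using v by simp
  then obtain p where p: "local_param a d (Infty, Fin v) p"
      and ord: "\<And>f. ord_at a d f (Infty, Fin v) = fls_subdegree (subst_fls f p)"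
    using ord_atE by blast
  obtain \<xi> \<eta> where pe: "p = (\<xi>, \<eta>)" by (cases p)
  have "fls_center \<xi> = Infty" "fls_center \<eta> = Fin v"
    using p by (auto simp: local_param_def Let_def pe)
  then have sub: "fls_subdegree \<xi> < 0" "fls_subdegree \<eta> \<ge> 0"
    by (auto simp: fls_center_def split: if_splits)
  then have \<xi>0: "\<xi> \<noteq> 0" by auto
  obtain y where y: "\<eta> = fps_to_fls y" using sub(2) by (rule fls_nonneg_subdegree_fps)
  have y0: "fps_nth y 0 = v" using \<open>fls_center \<eta> = Fin v\<close> by (simp add: y)
  obtain z where z: "inverse \<xi> = fps_to_fls z"
    using sub(1) fls_nonneg_subdegree_fps[of "inverse \<xi>"] by auto
  have \<xi>: "\<xi> = inverse (fps_to_fls z)" by (simp flip: z)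
  have z_nz: "fps_to_fls z \<noteq> 0" using \<xi>0 by (simp flip: z)
  have z0: "fps_nth z 0 = 0"
    using sub(1) unfolding \<xi> by (auto simp: fls_subdegree_fls_to_fps subdegree_pos_iff)
  have "fls_const a * \<xi> ^ 2 + \<eta> ^ 2 = 1 + fls_const d * \<xi> ^ 2 * \<eta> ^ 2"
    using p by (simp add: local_param_def Let_def pe)
  then have "fls_const a + fps_to_fls y ^ 2 * fps_to_fls z ^ 2 = fps_to_fls z ^ 2 + fls_const d * fps_to_fls y ^ 2"
    unfolding \<xi> y using z_nz by (simp add: field_simps)
  then have "fps_to_fls (fps_const a + y ^ 2 * z ^ 2) = fps_to_fls (z ^ 2 + fps_const d * y ^ 2)"
    by (simp add: fls_times_fps_to_fls fps_to_fls_power del: fps_to_fls_eq_iff)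
  then have curve: "fps_const a + y ^ 2 * z ^ 2 = z ^ 2 + fps_const d * y ^ 2"
    by (simp only: fps_to_fls_eq_iff)
  \<comment> \<open>As \<open>z\<close> vanishes at the point, degree one leaves only
    \<open>2 d v\<close> times the linear coefficient of \<open>y\<close>.\<close>
  have "fps_nth (fps_const a + y ^ 2 * z ^ 2) 1 = fps_nth (z ^ 2 + fps_const d * y ^ 2) 1"
    by (simp only: curve)
  then have y1: "fps_nth y 1 = 0"
    using v0 d_nz two_nz by (simp add: fps_mult_nth_1 power2_eq_square y0 z0 flip: mult_2)
  have "fls_subdegree (fls_local_coord \<xi>) = 1 \<or> fls_subdegree (fls_local_coord \<eta>) = 1"
    using p by (simp add: local_param_def Let_def pe)
  moreover have "fls_subdegree (fls_local_coord \<eta>) \<noteq> 1"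
  proof
    assume "fls_subdegree (fls_local_coord \<eta>) = 1"
    then have "subdegree (y - fps_const v) = 1"
      by (simp add: y fls_subdegree_local_coord_fps y0)
    then have "fps_nth (y - fps_const v) 1 \<noteq> 0" by (metis nth_subdegree_nonzero subdegree_0 zero_neq_one)
    then show False using y1 by simp
  qed
  ultimately have "fls_subdegree (inverse \<xi>) = 1"
    using sub(1) by (simp add: fls_local_coord_def)
  then have sub_z: "fls_subdegree (fps_to_fls z) = 1" by (simp only: z)
  define G where "G = eval_fps_poly A y * z + eval_fps_poly B y"
  have F: "subst_fls [:A, B:] p = inverse (fps_to_fls z) * fps_to_fls G"
    unfolding pe \<xi> y subst_fls_linear G_def using z_nz
    by (simp add: fls_times_fps_to_fls field_simps)
  have "fls_subdegree (inverse (fps_to_fls z) * fps_to_fls G) = int (subdegree G) - 1" if "G \<noteq> 0"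
    using that z_nz sub_z by (simp add: fls_subdegree_fls_to_fps)
  \<comment> \<open>For \<open>G = 0\<close> the subdegree is 0 by convention, which respects both
    bounds.\<close>
  then have ordG: "ord_at a d [:A, B:] (Infty, Fin v) = (if G = 0 then 0 else int (subdegree G) - 1)"
    unfolding ord F by auto
  then show "ord_at a d [:A, B:] (Infty, Fin v) \<ge> - 1" by simp
  show "ord_at a d [:A, B:] (Infty, Fin v) \<ge> 0" if "poly B v = 0"
  proof -
    have "fps_nth G 0 = 0" using that by (simp add: G_def z0 y0)
    then show ?thesis unfolding ordG by (auto simp: Suc_le_eq subdegree_pos_iff)
  qed
qed

lemma divisor_affine:
  assumes "(Fin s, Fin v) \<in> edwards a d"
  shows "divisor a d f (Affine s v) = ord_at a d f (Fin s, Fin v)"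
proof -
  have "to_plane P = Affine s v \<longleftrightarrow> P = (Fin s, Fin v)" for P
    by (cases P rule: to_plane.cases) auto
  then have "{P \<in> edwards a d. to_plane P = Affine s v} = {(Fin s, Fin v)}"
    using assms by auto
  then show ?thesis by (simp add: divisor_def)
qed

text \<open>Exactly two points \<open>(Infty, Fin v)\<close> and \<open>(Infty, Fin (- v))\<close>
  lie above \<open>Omega1\<close>, each of order at least -1. The total -2 leaves no room for the
  better bound that a zero of \<open>B\<close> would give.\<close>

lemma divisor_Omega1_root:
  assumes "divisor a d [:A, B:] Omega1 = - 2" "d * v ^ 2 = a"
  shows "poly B v \<noteq> 0"
proof
  assume B: "poly B v = 0"
  have v0: "v \<noteq> 0" using assms(2) a_nz by auto
  have "{P \<in> edwards a d. to_plane P = Omega1} = {(Infty, Fin v), (Infty, Fin (- v))}"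
  proof -
    have "P \<in> edwards a d \<and> to_plane P = Omega1 \<longleftrightarrow> P = (Infty, Fin v) \<or> P = (Infty, Fin (- v))" for P
    proof (cases P rule: to_plane.cases)
      case (2 y)
      show ?thesis
      proof (cases y)
        case (Fin w)
        have "d * w ^ 2 = a \<longleftrightarrow> w ^ 2 = v ^ 2" using assms(2) d_nz by auto
        then show ?thesis using 2 Fin by (auto simp: power2_eq_iff)
      qed (use 2 in simp)
    qed auto
    then show ?thesis by blast
  qed
  then have "divisor a d [:A, B:] Omega1 =
      ord_at a d [:A, B:] (Infty, Fin v) + ord_at a d [:A, B:] (Infty, Fin (- v))"
    using minus_neq_self[OF v0] by (auto simp: divisor_def)
  moreover have "ord_at a d [:A, B:] (Infty, Fin (- v)) \<ge> - 1"
    using assms(2) by (intro ord_at_infinity(1)) simp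
  ultimately show False
    using ord_at_infinity(2)[OF assms(2) B, of A] assms(1) by linarith
qed

end

section \<open>Transport of polynomials to the algebraic closure\<close>

lemma map_poly_to_ac_add [simp]: "map_poly to_ac (p + q) = map_poly to_ac p + map_poly to_ac q"
  by (rule map_poly_hom_add) simp_all

lemma map_poly_to_ac_diff: "map_poly to_ac (p - q) = map_poly to_ac p - map_poly to_ac q"
  by (rule poly_eqI) (simp add: coeff_map_poly)

lemma map_poly_to_ac_mult [simp]: "map_poly to_ac (p * q) = map_poly to_ac p * map_poly to_ac q"
  by (rule map_poly_hom_mult) simp_all

lemma map_poly_to_ac_1 [simp]: "map_poly to_ac 1 = 1"
  by (simp add: one_pCons map_poly_pCons)

lemma map_poly_to_ac_power [simp]: "map_poly to_ac (p ^ m) = map_poly to_ac p ^ m"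
  by (induction m) simp_all

lemma map_poly_to_ac_pCons [simp]: "map_poly to_ac (pCons c p) = pCons (to_ac c) (map_poly to_ac p)"
  by (simp add: map_poly_pCons)

lemma map_poly_to_ac_eq_iff [simp]: "map_poly to_ac p = map_poly to_ac q \<longleftrightarrow> p = q"
  by (auto simp: poly_eq_iff coeff_map_poly)

lemma map_poly_to_ac_eq_0_iff [simp]: "map_poly to_ac p = 0 \<longleftrightarrow> p = 0"
  using map_poly_to_ac_eq_iff[of p 0] by simp

lemma degree_map_poly_to_ac [simp]: "degree (map_poly to_ac p) = degree p"
  by (rule degree_map_poly) simp

section \<open>The Frobenius map\<close>

text \<open>Multiplication by \<open>c \<noteq> 0\<close> permutes the nonzero elements; comparing
  their products gives \<open>c^(q-1) = 1\<close>.\<close>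

lemma power_CARD_eq_self:
  fixes c :: "'q::{field,finite}"
  shows "c ^ CARD('q) = c"
proof (cases "c = 0")
  case False
  let ?U = "UNIV - {0::'q}"
  have "bij_betw ((*) c) ?U ?U"
    by (rule bij_betw_byWitness[of _ "\<lambda>y. y / c"]) (use False in auto)
  then have "(\<Prod>y\<in>?U. c * y) = \<Prod>?U" by (rule prod.reindex_bij_betw)
  then have "c ^ card ?U = 1" by (simp add: prod.distrib)
  then have "c ^ Suc (card ?U) = c" by (simp only: power_Suc mult_1_right)
  moreover have "Suc (card ?U) = CARD('q)"
    using finite_UNIV_card_ge_0[where 'a = 'q] by (simp add: card_Diff_singleton)
  ultimately show ?thesis by (simp only:)
qed (simp add: finite_UNIV_card_ge_0)

text \<open>
  The polynomials \<open>(X + 1)\<^sup>q\<close> and \<open>X\<^sup>q + 1\<close> are monic of degree \<open>q\<close> and agree at the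
  \<open>q\<close> elements of the field, so they are equal.
\<close>

lemma alg_closure_power_CARD_add:
  fixes x y :: "'q::{field,finite} alg_closure"
  shows "(x + y) ^ CARD('q) = x ^ CARD('q) + y ^ CARD('q)"
proof -
  let ?q = "CARD('q)"
  have q: "?q > 0" by (rule finite_UNIV_card_ge_0) simp
  define p1 p2 :: "'q poly" where "p1 = [:1, 1:] ^ ?q" and "p2 = [:0, 1:] ^ ?q + 1"
  have d1: "degree p1 = ?q" unfolding p1_def by (subst degree_power_eq) simp_all
  have d2: "degree ([:0, 1:] ^ ?q :: 'q poly) = ?q" by (subst degree_power_eq) simp_all
  then have d2': "degree p2 = ?q" unfolding p2_def using q by (subst degree_add_eq_left) simp_all
  have "lead_coeff p1 = 1" by (simp add: p1_def lead_coeff_power)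
  moreover have "lead_coeff ([:0, 1:] ^ ?q :: 'q poly) = 1" by (simp add: lead_coeff_power)
  then have "lead_coeff p2 = 1" unfolding d2' using q d2 by (simp add: p2_def)
  ultimately have "coeff p1 ?q = coeff p2 ?q" using d1 d2' by simp
  then have "p1 = p2"
    by (rule poly_eqI_degree_lead_coeff[where A = UNIV])
      (simp_all add: d1 d2', simp add: p1_def p2_def power_CARD_eq_self)
  then have "map_poly to_ac p1 = map_poly to_ac p2" by simp
  then have *: "poly (map_poly to_ac p1) z = poly (map_poly to_ac p2) z" for z by simp
  have **: "(z + 1) ^ ?q = z ^ ?q + 1" for z :: "'q alg_closure"
    using *[of z] by (simp add: p1_def p2_def add.commute)
  show ?thesis
  proof (cases "y = 0")
    case False
    then have "(x + y) ^ ?q = y ^ ?q * (x / y + 1) ^ ?q"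
      by (simp add: field_simps flip: power_mult_distrib)
    then show ?thesis using False unfolding ** by (simp add: field_simps)
  qed (use q in simp)
qed

section \<open>Field homomorphisms acting on points, with Frobenius as the instance\<close>

locale field_hom =
  fixes h :: "'k::field \<Rightarrow> 'l::field"
  assumes hom_1: "h 1 = 1" and hom_add: "h (x + y) = h x + h y" and hom_mult: "h (x * y) = h x * h y"
begin

lemma hom_0: "h 0 = 0" using hom_add[of 0 0] by (metis add_0_left add_cancel_left_right)

lemma hom_diff: "h (x - y) = h x - h y" using hom_add[of "x - y" y] by simp

lemma hom_minus: "h (- x) = - h x" using hom_diff[of 0 x] by (simp add: hom_0)

lemma hom_eq_0_iff: "h x = 0 \<longleftrightarrow> x = 0"
  by (metis hom_0 hom_1 hom_mult mult_zero_left right_inverse zero_neq_one)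

lemma hom_eq_iff: "h x = h y \<longleftrightarrow> x = y"
  using hom_eq_0_iff[of "x - y"] by (simp add: hom_diff)

lemma hom_divide: "h (x / y) = h x / h y"
  by (metis divide_eq_0_iff hom_0 hom_mult nonzero_eq_divide_eq hom_eq_0_iff div_by_0)

lemma hom_power: "h (x ^ m) = h x ^ m"
  by (induction m) (simp_all add: hom_1 hom_mult)

lemma p1_num_map: "p1_num (map_p1 h P) = h (p1_num P)"
  by (cases P) (simp_all add: hom_1)

lemma p1_den_map: "p1_den (map_p1 h P) = h (p1_den P)"
  by (cases P) (simp_all add: hom_1 hom_0)

lemma p1_of_map: "p1_of (h u) (h w) = map_p1 h (p1_of u w)"
  by (simp add: p1_of_def hom_eq_0_iff hom_divide)

abbreviation map_point :: "'k point \<Rightarrow> 'l point" where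
  "map_point \<equiv> map_prod (map_p1 h) (map_p1 h)"

text \<open>The addition law consists of ring operations, quotients and tests for zero, all
  respected by a homomorphism of fields.\<close>

lemma edwards_add_map:
  "edwards_add (h a) (h d) (map_point P) (map_point Q) = map_point (edwards_add a d P Q)"
  unfolding edwards_add_def Let_def fst_map_prod snd_map_prod p1_num_map p1_den_map
    hom_mult[symmetric] hom_add[symmetric] hom_diff[symmetric] p1_of_map
  by (simp add: hom_eq_0_iff)

lemma edwards_map: "map_point P \<in> edwards (h a) (h d) \<longleftrightarrow> P \<in> edwards a d"
  unfolding edwards_def case_prod_unfold mem_Collect_eq fst_map_prod snd_map_prod p1_num_map p1_den_map
    hom_mult[symmetric] hom_add[symmetric] hom_power[symmetric] hom_eq_iff ..

end

interpretation frob: field_hom "\<lambda>z :: 'q::{field,finite} alg_closure. z ^ CARD('q)"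
  by unfold_locales (simp_all add: alg_closure_power_CARD_add power_mult_distrib)

lemma to_ac_power_CARD [simp]: "to_ac (c :: 'q::{field,finite}) ^ CARD('q) = to_ac c"
  by (metis power_CARD_eq_self to_ac_power)

lemma power_commute: "(z ^ i) ^ j = (z ^ j) ^ i" for z :: "'a::monoid_mult"
  by (metis mult.commute power_mult)

lemma frob_zero [simp]: "frob edwards_zero = edwards_zero"
  by (simp add: frob_def edwards_zero_def finite_UNIV_card_ge_0)

lemma frob_edwards_add:
  "frob (edwards_add (to_ac a) (to_ac d) P Q) = edwards_add (to_ac a) (to_ac d) (frob P) (frob Q)"
  using frob.edwards_add_map[of "to_ac a" "to_ac d" P Q] by (simp add: frob_def)

lemma frob_in_edwards:
  "P \<in> edwards (to_ac a) (to_ac d) \<Longrightarrow> frob P \<in> edwards (to_ac a) (to_ac d)"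
  using frob.edwards_map[of P "to_ac a" "to_ac d"] by (simp add: frob_def)

lemma edwards_trace_frob: "edwards_trace m a d (frob P) = frob (edwards_trace m a d P)"
  by (induction m) (simp_all add: frob_edwards_add funpow_swap1)

lemma frob_funpow:
  fixes P :: "'q::{field,finite} alg_closure point"
  shows "(frob ^^ i) P = map_prod (map_p1 (\<lambda>z. z ^ (CARD('q) ^ i))) (map_p1 (\<lambda>z. z ^ (CARD('q) ^ i))) P"
proof (induction i)
  case 0
  then show ?case by (cases P) (simp add: p1.map_ident)
next
  case (Suc i)
  then show ?case
    by (cases P) (simp add: frob_def p1.map_comp o_def mult.commute flip: power_mult)
qed

lemma frob_funpow_affine:
  "(frob ^^ i) (Fin x, Fin y) = (Fin (x ^ (CARD('q) ^ i)), Fin (y ^ (CARD('q) ^ i)))"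
  for x :: "'q::{field,finite} alg_closure"
  by (simp add: frob_funpow)

lemma frob_funpow_rational_points:
  assumes "P \<in> rational_points n a d"
  shows "(frob ^^ n) P = P"
  using assms by (cases P) (auto simp: frob_funpow rational_points_def intro!: p1.map_ident_strong)

lemma frob_in_trace_zero:
  fixes a d :: "'q::{field,finite}"
  assumes "P \<in> trace_zero n a d"
  shows "frob P \<in> trace_zero n a d"
proof -
  have "frob P \<in> rational_points n a d"
    using assms frob_in_edwards[of P a d]
    by (auto simp: trace_zero_def rational_points_def frob_def p1.set_map subset_iff
        power_commute[of _ "CARD('q)"])
  then show ?thesis using assms by (simp add: trace_zero_def edwards_trace_frob)
qed

lemma frob_funpow_in_trace_zero: "P \<in> trace_zero n a d \<Longrightarrow> (frob ^^ i) P \<in> trace_zero n a d"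
  by (induction i) (simp_all add: frob_in_trace_zero)

lemma frob_funpow_mod:
  assumes "(frob ^^ n) P = P" shows "(frob ^^ i) P = (frob ^^ (i mod n)) P"
  using funpow_mod_eq[OF assms] by metis

lemma frob_funpow_inverse:
  assumes "(frob ^^ n) P' = P'" "j < n" "(frob ^^ j) P' = P"
  shows "P' = (frob ^^ (n - j)) P"
proof -
  have "(frob ^^ (n - j + j)) P' = (frob ^^ (n - j)) P"
    by (simp only: funpow_add comp_apply assms(3))
  then show ?thesis using assms(1,2) by simp
qed

section \<open>Points at infinity and of order two do not have trace zero\<close>

text \<open>Raising to the power \<open>q^i\<close> is a field homomorphism that negates
  \<open>z\<close>, so its \<open>n\<close>-th iterate sends \<open>z\<close> to
  \<open>(-1)^n z = -z\<close>. That iterate is also a power of \<open>z \<mapsto> z^(q^n)\<close>,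
  which fixes \<open>z\<close>.\<close>

lemma power_CARD_eq_minus_odd:
  fixes z :: "'q::{field,finite} alg_closure"
  assumes "z ^ (CARD('q) ^ i) = - z" "z ^ (CARD('q) ^ n) = z" "odd n"
  shows "z = - z"
proof -
  have "z ^ (CARD('q) ^ (i * m)) = (- 1) ^ m * z" for m
  proof (induction m)
    case (Suc m)
    interpret field_hom "\<lambda>z::'q alg_closure. z ^ (CARD('q) ^ i)"
    proof
      show "(x + y) ^ CARD('q) ^ i = x ^ CARD('q) ^ i + y ^ CARD('q) ^ i" for x y :: "'q alg_closure"
        by (induction i) (simp_all add: power_mult alg_closure_power_CARD_add mult.commute[of "CARD('q)"])
    qed (simp_all add: power_mult_distrib)
    have "z ^ (CARD('q) ^ (i * Suc m)) = (z ^ (CARD('q) ^ (i * m))) ^ (CARD('q) ^ i)"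
      by (simp add: power_add mult.commute flip: power_mult)
    also have "\<dots> = (- 1) ^ m * (- z)"
      using Suc by (simp only: hom_mult hom_power hom_minus hom_1 assms)
    finally show ?case by simp
  qed simp
  moreover have "z ^ (CARD('q) ^ (n * m)) = z" for m
    using assms(2) by (induction m) (simp_all add: power_add power_mult)
  ultimately show ?thesis
    using assms(3) by (metis mult.commute mult_minus1 power_minus_odd power_one)
qed

lemma edwards_trace_frob_fixed:
  assumes "frob P = P"
  shows "edwards_trace (Suc m) a d P = edwards_add (to_ac a) (to_ac d) (edwards_trace m a d P) P"
proof -
  have "(frob ^^ m) P = P" using assms by (induction m) simp_all
  then show ?thesis by simp
qed

text \<open>For a point fixed by Frobenius the trace is a repeated sum of \<open>P\<close>;
  \<open>A\<close> and \<open>B\<close> contain its even and odd multiples.\<close>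

lemma edwards_trace_alternating:
  assumes fixed: "frob P = P" and "edwards_zero \<in> A"
    and AB: "\<And>Q. Q \<in> A \<Longrightarrow> edwards_add (to_ac a) (to_ac d) Q P \<in> B"
    and BA: "\<And>Q. Q \<in> B \<Longrightarrow> edwards_add (to_ac a) (to_ac d) Q P \<in> A"
  shows "(even m \<longrightarrow> edwards_trace m a d P \<in> A) \<and> (odd m \<longrightarrow> edwards_trace m a d P \<in> B)"
proof (induction m)
  case (Suc m)
  then show ?case using AB BA unfolding edwards_trace_frob_fixed[OF fixed] by auto
qed (use assms(2) in auto)

text \<open>Each excluded point turns out to be fixed by Frobenius, so its trace is an odd multiple
  of it. These points have order two or four, and an odd multiple is never neutral.\<close>

lemma trace_zero_affine:
  fixes a d :: "'q::{field,finite}"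
  assumes "edwards_curve (to_ac a) (to_ac d)" and n: "odd n" and P: "P \<in> trace_zero n a d"
  obtains x y where "P = (Fin x, Fin y)" "(x, y) \<noteq> (0, - 1)"
proof -
  interpret edwards_curve "to_ac a" "to_ac d" by fact
  let ?add = "edwards_add (to_ac a) (to_ac d)"
  have PE: "P \<in> edwards (to_ac a) (to_ac d)" and tr: "edwards_trace n a d P = edwards_zero"
    and rat: "set_p1 (fst P) \<union> set_p1 (snd P) \<subseteq> {z. z ^ (CARD('q) ^ n) = z}"
    using P by (auto simp: trace_zero_def rational_points_def)
  have no_period2: False
    if "frob P = P" "edwards_zero \<notin> B" "edwards_zero \<in> A"
      "\<And>Q. Q \<in> A \<Longrightarrow> ?add Q P \<in> B" "\<And>Q. Q \<in> B \<Longrightarrow> ?add Q P \<in> A" for A B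
    using edwards_trace_alternating[of P A a d B n] that n tr by auto
  \<comment> \<open>Frobenius maps \<open>z\<close> to a root of the same quadratic equation, hence
    to \<open>z\<close> or \<open>-z\<close>; \<open>n\<close> being odd, the sign gives nothing
    new.\<close>
  have fixed: "z ^ CARD('q) = z" if "to_ac e * z ^ 2 = to_ac c" "z ^ (CARD('q) ^ n) = z" "e \<noteq> 0"
    for z :: "'q alg_closure" and c e :: 'q
  proof -
    have "to_ac e * (z ^ CARD('q)) ^ 2 = to_ac c"
      using arg_cong[OF that(1), of "\<lambda>z. z ^ CARD('q)"]
      by (simp add: power_mult_distrib power_commute[of z 2])
    then have "to_ac e * (z ^ CARD('q)) ^ 2 = to_ac e * z ^ 2" using that(1) by simp
    then have "(z ^ CARD('q)) ^ 2 = z ^ 2" using that(3) by simp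
    then have "z ^ CARD('q) = z \<or> z ^ CARD('q) = - z" by (simp add: power2_eq_iff)
    then show ?thesis using power_CARD_eq_minus_odd[of z 1 n] that(2) n by auto
  qed
  have nz: "a \<noteq> 0" "d \<noteq> 0" using a_nz d_nz by auto
  consider v where "P = (Infty, Fin v)" "to_ac d * v ^ 2 = to_ac a"
    | s where "P = (Fin s, Infty)" "to_ac d * s ^ 2 = 1" | x y where "P = (Fin x, Fin y)"
    using PE by (cases P; cases "fst P"; cases "snd P") auto
  then show ?thesis
  proof cases
    case 1
    have "frob P = P" using fixed[of d v a] 1 rat nz by (simp add: frob_def)
    moreover have v: "v \<noteq> 0" using 1 a_nz by auto
    have "?add edwards_zero P = P" "?add P P = edwards_zero"
      using 1 v a_nz by (auto simp: edwards_add_def Let_def edwards_zero_def p1_of_def power2_eq_square mult.assoc)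
    ultimately have False using no_period2[where A = "{edwards_zero}" and B = "{P}"] 1 by (auto simp: edwards_zero_def)
    then show ?thesis ..
  next
    case 2
    have s: "s \<noteq> 0" using 2 by auto
    have frobP: "frob P = P" using fixed[of d s 1] 2 rat nz by (simp add: frob_def)
    have dss: "to_ac d * s * s = 1" using 2 by (simp add: power2_eq_square mult.assoc)
    \<comment> \<open>The multiples of this point of order four run through \<open>P\<close>,
      \<open>?T\<close>, \<open>?P'\<close> and the neutral element.\<close>
    let ?P' = "(Fin (- s), Infty)" and ?T = "(Fin 0, Fin (- 1))"
    have "?add edwards_zero P = P" "?add P P = ?T" "?add ?T P = ?P'" "?add ?P' P = edwards_zero"
      using 2 s dss by (auto simp: edwards_add_def Let_def edwards_zero_def p1_of_def)
    then have False using no_period2[where A = "{edwards_zero, ?T}" and B = "{P, ?P'}"] 2 frobP by (auto simp: edwards_zero_def)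
    then show ?thesis ..
  next
    case 3
    have "(x, y) \<noteq> (0, - 1)"
    proof
      assume xy: "(x, y) = (0, - 1)"
      then have "frob P = P" using 3 by (simp add: frob_def frob.hom_minus finite_UNIV_card_ge_0)
      moreover have "?add edwards_zero P = P" "?add P P = edwards_zero"
        using 3 xy by (auto simp: edwards_add_def Let_def edwards_zero_def p1_of_def)
      moreover have "P \<noteq> edwards_zero"
        using minus_neq_self[of 1] 3 xy by (auto simp: edwards_zero_def)
      ultimately show False using no_period2[where A = "{edwards_zero}" and B = "{P}"] by auto
    qed
    with 3 that show ?thesis by blast
  qed
qed

section \<open>Zeros of the representing polynomials\<close>

definition frob_orbit ::
  "nat \<Rightarrow> 'q::{field,finite} alg_closure point \<Rightarrow> 'q alg_closure point set" where
  "frob_orbit n P = {(frob ^^ i) P | i. i < n}"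

lemma frob_funpow_in_orbit:
  assumes "(frob ^^ n) P = P" "n > 0"
  shows "(frob ^^ i) P \<in> frob_orbit n P"
  using frob_funpow_mod[OF assms(1), of i] assms(2) by (auto simp: frob_orbit_def)

lemma frob_funpow_closed_orbit:
  assumes "(frob ^^ n) P = P" "P' \<in> frob_orbit n P"
  shows "(frob ^^ i) P' \<in> frob_orbit n P"
proof -
  obtain j where "j < n" "P' = (frob ^^ j) P" using assms(2) by (auto simp: frob_orbit_def)
  then have "(frob ^^ i) P' = (frob ^^ (i + j)) P" by (simp add: funpow_add)
  then show ?thesis using frob_funpow_in_orbit[OF assms(1), of "i + j"] \<open>j < n\<close> by simp
qed

lemma frob_orbit_sym:
  assumes "(frob ^^ n) P = P" "P' \<in> frob_orbit n P"
  shows "(frob ^^ n) P' = P'" and "P \<in> frob_orbit n P'"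
proof -
  obtain j where j: "j < n" "P' = (frob ^^ j) P" using assms(2) by (auto simp: frob_orbit_def)
  have "(frob ^^ n) P' = (frob ^^ j) ((frob ^^ n) P)"
    unfolding j(2) by (metis add.commute comp_apply funpow_add)
  then show *: "(frob ^^ n) P' = P'" using assms(1) j by simp
  have "P = (frob ^^ (n - j)) P'" using frob_funpow_inverse[OF assms(1) j(1) j(2)[symmetric]] .
  then show "P \<in> frob_orbit n P'" using frob_funpow_in_orbit[OF *, of "n - j"] j(1) by simp
qed

text \<open>By Bezout \<open>i * s = n * t + 1\<close>; both iterates fix \<open>P\<close>, and they
  differ by one application of \<open>frob\<close>.\<close>

lemma frob_fixed_of_coprime:
  assumes "(frob ^^ i) P = P" "(frob ^^ n) P = P" "coprime i n" "i \<noteq> 0"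
  shows "frob P = P"
proof -
  have iter: "(frob ^^ (m * j)) P = P" if "(frob ^^ m) P = P" for m j
    using that by (induction j) (simp_all add: funpow_add)
  obtain s t where "i * s = n * t + 1" using bezout_nat[OF assms(4), of n] assms(3) by auto
  then have "(frob ^^ (n * t + 1)) P = P" using iter[OF assms(1), of s] by simp
  then show ?thesis using iter[OF assms(2), of t] by simp
qed

lemma to_plane_eq_Affine [simp]:
  "to_plane P = Affine s v \<longleftrightarrow> P = (Fin s, Fin v)"
  "Affine s v = to_plane P \<longleftrightarrow> P = (Fin s, Fin v)"
  by (cases P rule: to_plane.cases; auto)+

lemma coeff_Poly_beyond: "i \<ge> length xs \<Longrightarrow> coeff (Poly xs) i = 0"
  by (simp add: nth_default_beyond)

lemma degree_Poly_less: "xs \<noteq> [] \<Longrightarrow> degree (Poly xs) < length xs"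
  using degree_le[of "length xs - 1" "Poly xs"] coeff_Poly_beyond[of xs]
  by (cases xs) (auto simp: Suc_le_eq less_Suc_eq_le)

text \<open>\<open>Poly\<close> forgets trailing zeros, so the lists are recovered only because
  their lengths agree.\<close>

lemma Poly_eq_smult_imp:
  assumes "Poly ys = smult c (Poly xs)" "length ys = length xs"
  shows "ys = map ((*) c) xs"
proof (rule nth_equalityI)
  fix i assume "i < length ys"
  moreover have "coeff (Poly ys) i = c * coeff (Poly xs) i" by (simp add: assms(1) del: coeff_Poly_eq)
  ultimately show "ys ! i = map ((*) c) xs ! i" using assms(2) by (simp add: nth_default_nth)
qed (use assms in simp)

abbreviation ac_poly :: "'q::field list \<Rightarrow> 'q alg_closure poly" where
  "ac_poly xs \<equiv> map_poly to_ac (Poly xs)"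

section \<open>The curve over a finite field and the conjugates of a trace zero point\<close>

locale edwards_over_finite_field =
  fixes a d :: "'q::{field,finite}" and n :: nat
  assumes odd_char: "odd CHAR('q)" and odd_n: "odd n"
    and nz: "a \<noteq> 0" "d \<noteq> 0" and neq: "a \<noteq> d"

sublocale edwards_over_finite_field \<subseteq> edwards_curve "to_ac a" "to_ac d"
proof
  have "CHAR('q) \<noteq> 1" by simp
  then have "\<not> CHAR('q) dvd 2"
    using odd_char by (metis dvd_refl prime_nat_iff two_is_prime_nat)
  then have "of_nat 2 \<noteq> (0 :: 'q alg_closure)"
    by (simp only: of_nat_eq_0_iff_char_dvd CHAR_alg_closure not_False_eq_True)
  then show "(2 :: 'q alg_closure) \<noteq> 0" by simp
qed (use nz neq in auto)

context edwards_over_finite_field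
begin

lemma n_pos: "n > 0" using odd_n by (cases n) auto

lemma trace_zero_frob_n: "P \<in> trace_zero n a d \<Longrightarrow> (frob ^^ n) P = P"
  unfolding trace_zero_def using frob_funpow_rational_points by blast

lemma orbit_trace_zero: "P \<in> trace_zero n a d \<Longrightarrow> P' \<in> frob_orbit n P \<Longrightarrow> P' \<in> trace_zero n a d"
  by (auto simp: frob_orbit_def frob_funpow_in_trace_zero)

text \<open>On the curve \<open>y = -1\<close> forces \<open>x = 0\<close> because
  \<open>a \<noteq> d\<close>, so excluding \<open>(0, -1)\<close> excludes \<open>y = -1\<close>
  altogether.\<close>

lemma trace_zero_E:
  assumes "P \<in> trace_zero n a d"
  obtains x y where "P = (Fin x, Fin y)" "y \<noteq> - 1" "(Fin x, Fin y) \<in> edwards (to_ac a) (to_ac d)"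
proof -
  obtain x y where xy: "P = (Fin x, Fin y)" "(x, y) \<noteq> (0, - 1)"
    using trace_zero_affine[OF edwards_curve_axioms odd_n assms] .
  moreover have E: "(Fin x, Fin y) \<in> edwards (to_ac a) (to_ac d)"
    using assms xy(1) by (simp add: trace_zero_def rational_points_def)
  moreover have "y \<noteq> - 1"
  proof
    assume "y = - 1"
    then have "x = 0" using E a_neq_d by (simp add: edwards_affine(1))
    with xy \<open>y = - 1\<close> show False by simp
  qed
  ultimately show ?thesis using that by blast
qed

text \<open>Otherwise some power \<open>q^i\<close> would negate \<open>u\<close> while
  \<open>q^n\<close> fixes it, which for odd \<open>n\<close> means \<open>u = -u\<close>.\<close>

lemma orbit_not_opposite:
  assumes "P \<in> trace_zero n a d" "(Fin u, Fin v) \<in> frob_orbit n P" "(Fin (- u), Fin v) \<in> frob_orbit n P"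
  shows "u = 0"
proof -
  let ?S = "(Fin u, Fin v)"
  have Pn: "(frob ^^ n) P = P" using trace_zero_frob_n assms(1) by blast
  obtain j where j: "(Fin (- u), Fin v) = (frob ^^ j) P" using assms(3) by (auto simp: frob_orbit_def)
  have Sn: "(frob ^^ n) ?S = ?S" and "P \<in> frob_orbit n ?S" using frob_orbit_sym[OF Pn assms(2)] by auto
  then have "(frob ^^ j) P \<in> frob_orbit n ?S" by (rule frob_funpow_closed_orbit)
  then obtain i where "(Fin (- u), Fin v) = (frob ^^ i) ?S" unfolding j[symmetric] by (auto simp: frob_orbit_def)
  then have "u ^ (CARD('q) ^ i) = - u" by (simp add: frob_funpow_affine)
  moreover have "u ^ (CARD('q) ^ n) = u" using Sn by (simp add: frob_funpow_affine)
  ultimately have "u = - u" using power_CARD_eq_minus_odd odd_n by blast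
  then show ?thesis using minus_neq_self by metis
qed

text \<open>This is \<open>Q_P\<close> over the closure: \<open>(1 + y)\<close> times it, divided by
  \<open>a - d y^2\<close>, is the norm of \<open>qpoly as bs\<close> under
  \<open>x \<mapsto> -x\<close>.\<close>

definition norm_qpoly :: "'q list \<Rightarrow> 'q list \<Rightarrow> 'q alg_closure poly" where
  "norm_qpoly as bs = [:to_ac a, 0, - to_ac d:] * [:1, 1:] * ac_poly as ^ 2 + [:- 1, 1:] * ac_poly bs ^ 2"

section \<open>Zeros of one polynomial with the prescribed divisor\<close>

context
  fixes P as bs
  assumes P: "P \<in> trace_zero n a d" and qpoly: "is_qpoly n a d P as bs"
begin

lemma qpoly_eq: "qpoly as bs = [:[:1, 1:] * ac_poly as, ac_poly bs:]"
  by (simp add: qpoly_def)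

lemma divisor_qpoly:
  "divisor (to_ac a) (to_ac d) [:[:1, 1:] * ac_poly as, ac_poly bs:] Q =
     (\<Sum>i<n. single_point (to_plane ((frob ^^ i) P)) Q)
     + single_point (Affine 0 (- 1)) Q - 2 * single_point Omega1 Q - (int n - 1) * single_point Omega2 Q"
  using qpoly unfolding is_qpoly_def qpoly_eq[symmetric] by blast

lemma ord_at_qpoly:
  assumes "(Fin u, Fin v) \<in> edwards (to_ac a) (to_ac d)"
  shows "ord_at (to_ac a) (to_ac d) [:[:1, 1:] * ac_poly as, ac_poly bs:] (Fin u, Fin v) =
     (\<Sum>i<n. single_point (to_plane ((frob ^^ i) P)) (Affine u v))
     + single_point (Affine 0 (- 1)) (Affine u v)"
  unfolding divisor_affine[OF assms, symmetric] divisor_qpoly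
  by (simp add: single_point_def[of Omega1] single_point_def[of Omega2])

lemma orbit_sum_pos_iff:
  "(\<Sum>i<n. single_point (to_plane ((frob ^^ i) P)) (Affine u v)) > 0 \<longleftrightarrow> (Fin u, Fin v) \<in> frob_orbit n P"
proof -
  have eq: "single_point (to_plane ((frob ^^ i) P)) (Affine u v) = (if (frob ^^ i) P = (Fin u, Fin v) then 1 else 0)" for i
    by (simp add: single_point_def)
  have "(\<Sum>i<n. single_point (to_plane ((frob ^^ i) P)) (Affine u v)) \<noteq> 0 \<longleftrightarrow> (\<exists>i<n. (frob ^^ i) P = (Fin u, Fin v))"
    unfolding eq by (subst sum_nonneg_eq_0_iff) auto
  moreover have "(\<Sum>i<n. single_point (to_plane ((frob ^^ i) P)) (Affine u v)) \<ge> 0"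
    unfolding eq by (rule sum_nonneg) simp
  moreover have "(\<exists>i<n. (frob ^^ i) P = (Fin u, Fin v)) \<longleftrightarrow> (Fin u, Fin v) \<in> frob_orbit n P"
    by (force simp: frob_orbit_def)
  ultimately show ?thesis by (metis order.order_iff_strict order.strict_implies_not_eq)
qed

lemma two_torsion_notin_orbit: "(Fin 0, Fin (- 1)) \<notin> frob_orbit n P"
  using orbit_trace_zero[OF P] trace_zero_E by (metis Pair_inject p1.inject)

text \<open>No conjugate of \<open>P\<close> equals \<open>(0, -1)\<close>, so the order there is
  exactly one.\<close>

lemma coeff_x_minus_one_nonzero: "poly (ac_poly bs) (- 1) \<noteq> 0"
proof (rule ord_at_two_torsion)
  have E: "(Fin 0, Fin (- 1)) \<in> edwards (to_ac a) (to_ac d)" by (simp add: edwards_affine(1))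
  have "(\<Sum>i<n. single_point (to_plane ((frob ^^ i) P)) (Affine 0 (- 1))) = 0"
    by (rule sum.neutral) (use two_torsion_notin_orbit in \<open>force simp: single_point_def frob_orbit_def\<close>)
  then show "ord_at (to_ac a) (to_ac d) [:[:1, 1:] * ac_poly as, ac_poly bs:] (Fin 0, Fin (- 1)) = 1"
    unfolding ord_at_qpoly[OF E] by (simp add: single_point_def)
qed

text \<open>All conjugates are affine, so the coefficient at \<open>Omega1\<close> is exactly
  -2.\<close>

lemma coeff_x_infinity_nonzero:
  assumes "to_ac d * v ^ 2 = to_ac a" shows "poly (ac_poly bs) v \<noteq> 0"
proof (rule divisor_Omega1_root[OF _ assms])
  have "single_point (to_plane ((frob ^^ i) P)) Omega1 = 0" for i
  proof -
    have "(frob ^^ i) P \<in> trace_zero n a d" using P by (rule frob_funpow_in_trace_zero)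
    then obtain x y where "(frob ^^ i) P = (Fin x, Fin y)" by (rule trace_zero_E)
    then show ?thesis by (simp add: single_point_def)
  qed
  then show "divisor (to_ac a) (to_ac d) [:[:1, 1:] * ac_poly as, ac_poly bs:] Omega1 = - 2"
    unfolding divisor_qpoly by (simp add: single_point_def)
qed

lemma poly_norm_qpoly:
  "poly (norm_qpoly as bs) v = (to_ac a - to_ac d * v ^ 2) * (1 + v) * poly (ac_poly as) v ^ 2 + (v - 1) * poly (ac_poly bs) v ^ 2"
  by (simp add: norm_qpoly_def power2_eq_square algebra_simps)

lemma norm_qpoly_minus_one: "poly (norm_qpoly as bs) (- 1) \<noteq> 0"
  using coeff_x_minus_one_nonzero two_nz by (simp add: poly_norm_qpoly)

text \<open>A zero of the function has positive order and so occurs in the divisor, where away from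
  \<open>(0, -1)\<close> only conjugates of \<open>P\<close> contribute positively. The norm is a
  nonzero polynomial because it does not vanish at -1 after removal of the factor
  \<open>1 + y\<close>.\<close>

lemma root_in_orbit:
  assumes E: "(Fin u, Fin v) \<in> edwards (to_ac a) (to_ac d)" and "v \<noteq> - 1"
    and root: "(1 + v) * poly (ac_poly as) v + u * poly (ac_poly bs) v = 0"
  shows "(Fin u, Fin v) \<in> frob_orbit n P"
proof -
  have "[:to_ac a, 0, - to_ac d:] * ([:1, 1:] * ac_poly as) ^ 2 - [:1, 0, - 1:] * ac_poly bs ^ 2 = [:1, 1:] * norm_qpoly as bs"
  proof -
    have factor: "[:1, 0, - 1:] = - ([:1, 1:] * [:- 1, 1:] :: 'q alg_closure poly)" by simp
    have "K * (L * A) ^ 2 - - (L * M) * B ^ 2 = L * (K * L * A ^ 2 + M * B ^ 2)"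
      for A B K L M :: "'q alg_closure poly"
      by (simp add: power2_eq_square algebra_simps)
    then show ?thesis unfolding factor norm_qpoly_def .
  qed
  moreover have "norm_qpoly as bs \<noteq> 0" using norm_qpoly_minus_one by auto
  ultimately have "ord_at (to_ac a) (to_ac d) [:[:1, 1:] * ac_poly as, ac_poly bs:] (Fin u, Fin v) > 0"
    using root by (intro root_imp_ord_at_pos[OF E]) (auto simp: algebra_simps simp del: mult_pCons_left)
  then have "(\<Sum>i<n. single_point (to_plane ((frob ^^ i) P)) (Affine u v)) > 0"
    using assms(2) unfolding ord_at_qpoly[OF E] by (simp add: single_point_def[of "Affine _ _"])
  then show ?thesis using orbit_sum_pos_iff by blast
qed

lemma orbit_root:
  assumes "(Fin u, Fin v) \<in> frob_orbit n P"
  shows "(1 + v) * poly (ac_poly as) v + u * poly (ac_poly bs) v = 0"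
proof -
  have "(Fin u, Fin v) \<in> trace_zero n a d" using orbit_trace_zero[OF P assms] .
  then have E: "(Fin u, Fin v) \<in> edwards (to_ac a) (to_ac d)" by (rule trace_zero_E) auto
  have "ord_at (to_ac a) (to_ac d) [:[:1, 1:] * ac_poly as, ac_poly bs:] (Fin u, Fin v) > 0"
  proof -
    have "single_point (Affine 0 (- 1)) (Affine u v) \<ge> 0" by (simp add: single_point_def)
    then show ?thesis unfolding ord_at_qpoly[OF E] using orbit_sum_pos_iff[of u v] assms by linarith
  qed
  then have "poly ([:1, 1:] * ac_poly as) v + u * poly (ac_poly bs) v = 0" by (rule ord_at_pos_imp_root[OF E])
  then show ?thesis by (simp add: algebra_simps)
qed

text \<open>
  Over a common zero \<open>v \<noteq> 1\<close> of the two coefficients lie two points \<open>(u, v)\<close> and \<open>(-u, v)\<close>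
  where the function vanishes; they cannot be conjugate because \<open>n\<close> is odd.
\<close>

lemma common_root:
  assumes q1: "poly (ac_poly as) v = 0" and q2: "poly (ac_poly bs) v = 0"
  shows "v = 1" and "frob P = P"
proof -
  have vm: "v \<noteq> - 1" using q2 coeff_x_minus_one_nonzero by auto
  have av: "to_ac a - to_ac d * v ^ 2 \<noteq> 0" using q2 coeff_x_infinity_nonzero[of v] by auto
  obtain u where u: "u ^ 2 = (1 - v ^ 2) / (to_ac a - to_ac d * v ^ 2)"
    using nth_root_exists[of 2 "(1 - v ^ 2) / (to_ac a - to_ac d * v ^ 2)"] by auto
  then have E: "(Fin u, Fin v) \<in> edwards (to_ac a) (to_ac d)"
      "(Fin (- u), Fin v) \<in> edwards (to_ac a) (to_ac d)"
    using av by (simp_all add: edwards_affine(1))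
  then have O: "(Fin u, Fin v) \<in> frob_orbit n P" "(Fin (- u), Fin v) \<in> frob_orbit n P"
    using root_in_orbit vm q1 q2 by auto
  then have u0: "u = 0" using orbit_not_opposite[OF P] by blast
  then have "v ^ 2 = 1" using u av by simp
  then show v: "v = 1" using vm by (simp add: power2_eq_1_iff)
  have Pn: "(frob ^^ n) P = P" using P by (rule trace_zero_frob_n)
  \<comment> \<open>The neutral element is a conjugate of \<open>P\<close> and is fixed by
    Frobenius, so \<open>P\<close> is the neutral element.\<close>
  have "edwards_zero \<in> frob_orbit n P" using O(1) by (simp add: u0 v edwards_zero_def)
  then obtain j where "j < n" "(frob ^^ j) P = edwards_zero" by (force simp: frob_orbit_def)
  then have "P = (frob ^^ (n - j)) edwards_zero" using frob_funpow_inverse[OF Pn] by blast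
  moreover have "(frob ^^ m) edwards_zero = (edwards_zero :: 'q alg_closure point)" for m
    by (induction m) simp_all
  ultimately show "frob P = P" by simp
qed

text \<open>If the second coefficient vanished at \<open>v\<close>, so would the first: the factors
  \<open>a - d v^2\<close> and \<open>1 + v\<close> are nonzero there. A common root is excluded
  unless \<open>v = 1\<close>.\<close>

lemma norm_root_coeff_x_nonzero:
  assumes "poly (norm_qpoly as bs) v = 0" "v \<noteq> 1"
  shows "poly (ac_poly bs) v \<noteq> 0"
proof
  assume Q2: "poly (ac_poly bs) v = 0"
  then have "(to_ac a - to_ac d * v ^ 2) * (1 + v) * poly (ac_poly as) v ^ 2 = 0"
    using assms(1) by (simp add: poly_norm_qpoly)
  moreover have "to_ac a - to_ac d * v ^ 2 \<noteq> 0" using Q2 coeff_x_infinity_nonzero[of v] by auto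
  moreover have "1 + v \<noteq> 0" using Q2 coeff_x_minus_one_nonzero by (metis add_eq_0_iff)
  ultimately have "poly (ac_poly as) v = 0" by simp
  then show False using common_root(1) Q2 assms(2) by blast
qed

text \<open>For \<open>v \<noteq> 1\<close> the formula for \<open>u\<close> solves
  \<open>q_P(u, v) = 0\<close>, and vanishing of the norm is what places \<open>(u, v)\<close> on
  the curve. At \<open>v = 1\<close> it forces the first coefficient to vanish, so
  \<open>(0, 1)\<close> is a zero.\<close>

lemma norm_root_orbit:
  assumes root: "poly (norm_qpoly as bs) v = 0"
  shows "(Fin (if v = 1 then 0 else - (poly (ac_poly as) v * (v + 1) / poly (ac_poly bs) v)), Fin v) \<in> frob_orbit n P"
proof (cases "v = 1")
  case True
  then have "(to_ac a - to_ac d) * 2 * poly (ac_poly as) 1 ^ 2 = 0" using root by (simp add: poly_norm_qpoly)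
  then have "poly (ac_poly as) 1 = 0" using a_neq_d two_nz by simp
  moreover have "(1 :: 'q alg_closure) \<noteq> - 1" using minus_neq_self[of 1] by simp
  ultimately show ?thesis using True root_in_orbit[of 0 1] by (simp add: edwards_affine(1))
next
  case False
  define u where "u = - (poly (ac_poly as) v * (v + 1) / poly (ac_poly bs) v)"
  have Q2: "poly (ac_poly bs) v \<noteq> 0" using norm_root_coeff_x_nonzero root False by blast
  have vm: "v \<noteq> - 1" using root norm_qpoly_minus_one by auto
  have uQ: "u * poly (ac_poly bs) v = - (poly (ac_poly as) v * (v + 1))" using Q2 by (simp add: u_def)
  have "u ^ 2 * (to_ac a - to_ac d * v ^ 2) * poly (ac_poly bs) v ^ 2
      = (u * poly (ac_poly bs) v) ^ 2 * (to_ac a - to_ac d * v ^ 2)" by (simp only: power_mult_distrib mult_ac)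
  also have "\<dots> = (1 + v) * ((to_ac a - to_ac d * v ^ 2) * (1 + v) * poly (ac_poly as) v ^ 2)"
    unfolding uQ by (simp add: power2_eq_square algebra_simps)
  also have "\<dots> = (1 + v) * (- ((v - 1) * poly (ac_poly bs) v ^ 2))"
  proof -
    have "(to_ac a - to_ac d * v ^ 2) * (1 + v) * poly (ac_poly as) v ^ 2 = - ((v - 1) * poly (ac_poly bs) v ^ 2)"
      using root by (simp only: poly_norm_qpoly eq_neg_iff_add_eq_0)
    then show ?thesis by (simp only:)
  qed
  also have "\<dots> = (1 - v ^ 2) * poly (ac_poly bs) v ^ 2" by (simp add: power2_eq_square algebra_simps)
  finally have "(Fin u, Fin v) \<in> edwards (to_ac a) (to_ac d)"
    using Q2 by (simp add: edwards_affine(1))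
  then have "(Fin u, Fin v) \<in> frob_orbit n P"
    using vm by (rule root_in_orbit) (simp add: uQ algebra_simps)
  then show ?thesis using False by (simp add: u_def)
qed

end

section \<open>Proportionality of the polynomials of conjugate points\<close>

text \<open>Conjugates with equal \<open>y\<close> have equal \<open>x\<close> up to sign, and
  opposite signs occur only for \<open>x = 0\<close>. So two of them would coincide, and as
  \<open>n\<close> is prime Frobenius would fix \<open>P\<close>.\<close>

lemma orbit_y_coordinates:
  assumes "prime n" and P: "P \<in> trace_zero n a d" and "frob P \<noteq> P"
  shows "\<exists>yc. card yc = n \<and> (\<forall>v\<in>yc. v \<noteq> - 1 \<and> (\<exists>u. (Fin u, Fin v) \<in> frob_orbit n P))"
proof -
  have Pn: "(frob ^^ n) P = P" using P by (rule trace_zero_frob_n)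
  obtain x y where xy: "P = (Fin x, Fin y)" using P by (rule trace_zero_E)
  define xc where "xc = (\<lambda>i. x ^ (CARD('q) ^ i))"
  define yc where "yc = (\<lambda>i. y ^ (CARD('q) ^ i))"
  have XY: "(frob ^^ i) P = (Fin (xc i), Fin (yc i))" for i
    by (simp add: xy xc_def yc_def frob_funpow_affine)
  have orbit: "(Fin (xc i), Fin (yc i)) \<in> frob_orbit n P" for i
    using frob_funpow_in_orbit[OF Pn n_pos, of i] by (simp add: XY)
  have E: "(Fin (xc i), Fin (yc i)) \<in> edwards (to_ac a) (to_ac d)" "yc i \<noteq> - 1" for i
    using trace_zero_E[OF orbit_trace_zero[OF P orbit[of i]]] by auto
  have ineq: "yc i \<noteq> yc j" if "i < j" "j < n" for i j
  proof
    assume Yij: "yc i = yc j"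
    have "xc i ^ 2 * (to_ac a - to_ac d * yc j ^ 2) = xc j ^ 2 * (to_ac a - to_ac d * yc j ^ 2)"
      using E(1)[of i] E(1)[of j] Yij by (simp add: edwards_affine(1))
    then have "xc i ^ 2 = xc j ^ 2" using edwards_affine_x_den[OF E(1)[of j]] by simp
    then have "xc i = xc j \<or> xc i = - xc j" by (simp add: power2_eq_iff)
    moreover have "xc j = 0" if "xc i = - xc j"
      using orbit_not_opposite[OF P orbit[of j]] orbit[of i] by (simp add: that Yij)
    ultimately have "xc i = xc j" by auto
    let ?S = "(frob ^^ i) P"
    have S: "?S \<in> frob_orbit n P" by (rule frob_funpow_in_orbit[OF Pn n_pos])
    have Sn: "(frob ^^ n) ?S = ?S" by (rule frob_orbit_sym(1)[OF Pn S])
    have "(frob ^^ (j - i)) ?S = (frob ^^ j) P"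
      using that(1) by (simp flip: comp_apply[of "frob ^^ (j - i)"] funpow_add)
    then have "(frob ^^ (j - i)) ?S = ?S" unfolding XY using Yij \<open>xc i = xc j\<close> by simp
    moreover have "coprime (j - i) n"
    proof (rule prime_imp_coprime_nat[OF \<open>prime n\<close>, THEN coprime_commute[THEN iffD1]])
      show "\<not> n dvd j - i" using that by (simp add: nat_dvd_not_less)
    qed
    ultimately have "frob ?S = ?S" using Sn that(1) by (intro frob_fixed_of_coprime[of "j - i" _ n]) auto
    then have "(frob ^^ m) ?S = ?S" for m by (induction m) simp_all
    moreover obtain m where "P = (frob ^^ m) ?S"
      using frob_orbit_sym(2)[OF Pn S] by (auto simp: frob_orbit_def)
    ultimately have "P = ?S" by simp
    with \<open>frob ?S = ?S\<close> \<open>frob P \<noteq> P\<close> show False by simp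
  qed
  then have "inj_on yc {..<n}" by (metis inj_onI lessThan_iff linorder_neqE_nat)
  then have "card (yc ` {..<n}) = n" by (simp add: card_image)
  then show ?thesis using E(2) orbit by (intro exI[of _ "yc ` {..<n}"]) auto
qed

text \<open>
  The \<open>n\<close> conjugates have distinct \<open>y\<close>-coordinates, at all of which
  \<open>q\<^sub>1 q\<^sub>2' - q\<^sub>1' q\<^sub>2\<close> vanishes; its degree is less than \<open>n\<close>, so it is zero.
\<close>

lemma qpoly_unique_up_to_scalar:
  assumes "prime n" and P: "P \<in> trace_zero n a d" and P': "P' \<in> frob_orbit n P" and moved: "frob P \<noteq> P"
    and q: "is_qpoly n a d P as bs" and q': "is_qpoly n a d P' as' bs'"
  obtains c where "c \<noteq> 0" "as' = map ((*) c) as" "bs' = map ((*) c) bs"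
proof -
  let ?q1 = "Poly as" and ?q2 = "Poly bs" and ?q1' = "Poly as'" and ?q2' = "Poly bs'"
  have Pn: "(frob ^^ n) P = P" using P by (rule trace_zero_frob_n)
  have P'T: "P' \<in> trace_zero n a d" using P P' by (rule orbit_trace_zero)
  have P_orbit: "P \<in> frob_orbit n P'" and P'n: "(frob ^^ n) P' = P'" using frob_orbit_sym[OF Pn P'] by auto
  have orbits: "S \<in> frob_orbit n P'" if "S \<in> frob_orbit n P" for S
    using that frob_funpow_closed_orbit[OF P'n P_orbit] by (auto simp: frob_orbit_def[of n P])
  have moved': "frob P' \<noteq> P'"
  proof
    assume fixed: "frob P' = P'"
    have "(frob ^^ m) P' = P'" for m using fixed by (induction m) simp_all
    then show False using P_orbit fixed moved by (auto simp: frob_orbit_def)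
  qed
  have len: "length as = (n - 1) div 2" "length bs = (n + 1) div 2"
     "length as' = (n - 1) div 2" "length bs' = (n + 1) div 2"
    using q q' by (auto simp: is_qpoly_def)
  have bs: "bs \<noteq> []" "bs' \<noteq> []" using len n_pos odd_n by (auto elim: oddE)
  define D where "D = ?q1 * ?q2' - ?q1' * ?q2"
  have "D = 0"
  proof (rule ccontr)
    assume nz: "D \<noteq> 0"
    obtain Y where Y: "card Y = n" "\<And>v. v \<in> Y \<Longrightarrow> v \<noteq> - 1 \<and> (\<exists>u. (Fin u, Fin v) \<in> frob_orbit n P)"
      using orbit_y_coordinates[OF \<open>prime n\<close> P moved] by blast
    have "poly (map_poly to_ac D) v = 0" if v: "v \<in> Y" for v
    proof -
      obtain u where u: "(Fin u, Fin v) \<in> frob_orbit n P" and vm: "v \<noteq> - 1" using Y(2)[OF v] by blast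
      \<comment> \<open>Both functions vanish at \<open>(u, v)\<close>, so their coefficient vectors
        are dependent there; the factor \<open>1 + v\<close> is then cancelled.\<close>
      have "(1 + v) * poly (map_poly to_ac D) v
        = ((1 + v) * poly (ac_poly as) v) * poly (ac_poly bs') v - ((1 + v) * poly (ac_poly as') v) * poly (ac_poly bs) v"
        by (simp add: D_def map_poly_to_ac_diff algebra_simps)
      also have "\<dots> = (- (u * poly (ac_poly bs) v)) * poly (ac_poly bs') v - (- (u * poly (ac_poly bs') v)) * poly (ac_poly bs) v"
        using orbit_root[OF P q u] orbit_root[OF P'T q' orbits[OF u]] by (simp only: eq_neg_iff_add_eq_0[symmetric])
      finally have "(1 + v) * poly (map_poly to_ac D) v = 0" by (simp add: algebra_simps)
      moreover have "1 + v \<noteq> 0" using vm by (metis add_eq_0_iff)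
      ultimately show ?thesis by simp
    qed
    then have "n \<le> card {v. poly (map_poly to_ac D) v = 0}"
      unfolding Y(1)[symmetric] using nz by (intro card_mono poly_roots_finite) auto
    also have "\<dots> \<le> degree D"
      using card_poly_roots_bound[of "map_poly to_ac D"] nz by simp
    also have "\<dots> < n"
    proof -
      \<comment> \<open>The \<open>bs\<close> lists are one entry longer than the \<open>as\<close>
        lists, hence the strict length bound for them; the products have degree at most
        \<open>n - 1\<close>.\<close>
      have "degree ?q1 \<le> (n - 1) div 2" "degree ?q1' \<le> (n - 1) div 2"
        using degree_Poly[of as] degree_Poly[of as'] len by auto
      moreover have "degree ?q2 \<le> (n - 1) div 2" "degree ?q2' \<le> (n - 1) div 2"
        using degree_Poly_less[OF bs(1)] degree_Poly_less[OF bs(2)] len odd_n by (auto elim!: oddE)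
      ultimately have "degree (?q1 * ?q2') \<le> (n - 1) div 2 + (n - 1) div 2"
          "degree (?q1' * ?q2) \<le> (n - 1) div 2 + (n - 1) div 2"
        by (meson add_mono degree_mult_le order_trans)+
      then have "degree D \<le> (n - 1) div 2 + (n - 1) div 2"
        unfolding D_def by (rule degree_diff_le)
      then show ?thesis using odd_n n_pos by (auto elim!: oddE)
    qed
    finally show False by simp
  qed
  then have cross: "?q1 * ?q2' = ?q1' * ?q2" by (simp add: D_def)
  obtain g s t where g: "g = s * ?q1 + t * ?q2" "g dvd ?q1" "g dvd ?q2" using poly_bezout by blast
  \<comment> \<open>A common divisor with a root in the closure would give a common root of both
    coefficients, forcing the point to be fixed by Frobenius.\<close>
  have no_root: "\<exists>c. f = [:c:] \<and> c \<noteq> 0" if "f dvd Poly xs" "f dvd Poly ys"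
    "is_qpoly n a d S xs ys" "S \<in> trace_zero n a d" "frob S \<noteq> S" for f xs ys S
  proof -
    have no: "poly (map_poly to_ac f) v \<noteq> 0" for v
    proof
      assume "poly (map_poly to_ac f) v = 0"
      then have "poly (ac_poly xs) v = 0" "poly (ac_poly ys) v = 0"
        using that(1,2) by (auto simp: elim!: dvdE)
      then show False using common_root(2)[OF that(4,3)] that(5) by blast
    qed
    then have "degree f = 0"
      using alg_closed_imp_poly_has_root[of "map_poly to_ac f"] by auto
    then show ?thesis using no[of 0] by (auto elim!: degree_eq_zeroE)
  qed
  \<comment> \<open>The Bezout combination for \<open>g\<close>, taken of the primed polynomials. By
    \<open>cross\<close> it converts one pair into the other; as \<open>g\<close> is constant,
    \<open>k\<close> divides both primed polynomials and is constant too.\<close>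
  define k where "k = s * ?q1' + t * ?q2'"
  have k: "?q1 * k = g * ?q1'" "?q2 * k = g * ?q2'"
    using cross by (simp_all add: k_def g(1) algebra_simps)
  obtain \<gamma> where \<gamma>: "g = [:\<gamma>:]" "\<gamma> \<noteq> 0"
    using no_root[OF g(2,3) q P moved] by blast
  have "k dvd smult \<gamma> ?q1'" "k dvd smult \<gamma> ?q2'"
    using k unfolding \<gamma>(1) by (metis dvd_triv_right mult_pCons_left mult_zero_left pCons_0_0 add_0_right)+
  then have "k dvd ?q1'" "k dvd ?q2'" using \<gamma>(2) by (simp_all add: dvd_smult_iff)
  then obtain \<kappa> where \<kappa>: "k = [:\<kappa>:]" "\<kappa> \<noteq> 0"
    using no_root[OF _ _ q' P'T moved'] by blast
  define c where "c = \<kappa> / \<gamma>"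
  have "Poly as' = smult c ?q1" "Poly bs' = smult c ?q2"
    using k \<gamma> \<kappa> by (simp_all add: c_def poly_eq_iff field_simps)
  then have "as' = map ((*) c) as" "bs' = map ((*) c) bs"
    using len by (auto intro!: Poly_eq_smult_imp)
  moreover have "c \<noteq> 0" using \<gamma> \<kappa> by (simp add: c_def)
  ultimately show ?thesis using that by blast
qed

section \<open>The fibres of the representation\<close>

text \<open>\<open>P'\<close> is a zero of its own polynomial, and by \<open>root_in_orbit\<close>
  the zeros of that polynomial with \<open>y \<noteq> -1\<close> are conjugates of
  \<open>P\<close>.\<close>

lemma orbit_of_same_qpoly:
  assumes P: "P \<in> trace_zero n a d" "P' \<in> trace_zero n a d"
    and q: "is_qpoly n a d P as bs" "is_qpoly n a d P' as bs"
  shows "P' \<in> frob_orbit n P"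
proof -
  obtain x y where xy: "P' = (Fin x, Fin y)" "y \<noteq> - 1" "(Fin x, Fin y) \<in> edwards (to_ac a) (to_ac d)"
    using P(2) by (rule trace_zero_E)
  have "P' \<in> frob_orbit n P'" using frob_funpow_in_orbit[OF trace_zero_frob_n[OF P(2)] n_pos, of 0] by simp
  then have "(1 + y) * poly (ac_poly as) y + x * poly (ac_poly bs) y = 0"
    using orbit_root[OF P(2) q(2)] xy(1) by blast
  then show ?thesis unfolding xy(1) by (rule root_in_orbit[OF P(1) q(1) xy(3,2)])
qed

lemma representationE:
  assumes "is_representation n a d R" "P \<in> trace_zero n a d" "R P = (\<alpha>, b)"
  obtains as bs where "is_qpoly n a d P as bs" "\<alpha> = as @ butlast bs" "b = last bs"
    "length as = (n - 1) div 2" "length bs = Suc ((n - 1) div 2)"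
proof -
  obtain as bs where "is_qpoly n a d P as bs" "R P = (as @ butlast bs, last bs)"
    using assms(1,2) unfolding is_representation_def by blast
  moreover from this have "length as = (n - 1) div 2" "length bs = Suc ((n - 1) div 2)"
    using odd_n by (auto simp: is_qpoly_def elim!: oddE)
  ultimately show ?thesis using that assms(3) by simp
qed

text \<open>Equal values give equal polynomials, hence conjugate points. Conversely the polynomials
  of conjugates are proportional, and the scalar condition in \<open>is_representation\<close> turns
  this into equality.\<close>

lemma representation_fibre:
  assumes "prime n" and R: "is_representation n a d R" and P: "P \<in> trace_zero n a d"
  shows "{P' \<in> trace_zero n a d. R P' = R P} = frob_orbit n P"
proof (intro equalityI subsetI)
  fix P' assume "P' \<in> {P' \<in> trace_zero n a d. R P' = R P}"
  then have P': "P' \<in> trace_zero n a d" "R P' = R P" by auto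
  obtain \<alpha> b where Rb: "R P = (\<alpha>, b)" by (cases "R P")
  obtain as bs where 1: "is_qpoly n a d P as bs" "\<alpha> = as @ butlast bs" "b = last bs"
    "length as = (n - 1) div 2" "length bs = Suc ((n - 1) div 2)"
    using representationE[OF R P Rb] .
  obtain as' bs' where 2: "is_qpoly n a d P' as' bs'" "\<alpha> = as' @ butlast bs'" "b = last bs'"
    "length as' = (n - 1) div 2" "length bs' = Suc ((n - 1) div 2)"
    using representationE[OF R P'(1), of \<alpha> b] P'(2) Rb by auto
  \<comment> \<open>The known lengths determine where \<open>\<alpha>\<close> is split.\<close>
  have "as = as'" "butlast bs = butlast bs'" using 1(2,4) 2(2,4) by auto
  moreover have "bs \<noteq> []" "bs' \<noteq> []" using 1(5) 2(5) by auto
  then have "bs = bs'"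
    using 1(3) 2(3) \<open>butlast bs = butlast bs'\<close> by (metis append_butlast_last_id)
  ultimately show "P' \<in> frob_orbit n P" using orbit_of_same_qpoly[OF P P'(1) 1(1)] 2(1) by simp
next
  fix P' assume P': "P' \<in> frob_orbit n P"
  then have P'T: "P' \<in> trace_zero n a d" by (rule orbit_trace_zero[OF P])
  have "R P' = R P"
  proof (cases "frob P = P")
    case True
    then have "(frob ^^ i) P = P" for i by (induction i) simp_all
    then show ?thesis using P' by (auto simp: frob_orbit_def)
  next
    case False
    obtain as bs where 1: "is_qpoly n a d P as bs" "R P = (as @ butlast bs, last bs)"
      using R P unfolding is_representation_def by blast
    obtain as' bs' where 2: "is_qpoly n a d P' as' bs'" "R P' = (as' @ butlast bs', last bs')"
      using R P'T unfolding is_representation_def by blast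
    obtain c where c: "c \<noteq> 0" "as' = map ((*) c) as" "bs' = map ((*) c) bs"
      using qpoly_unique_up_to_scalar[OF \<open>prime n\<close> P P' False 1(1) 2(1)] .
    have "bs \<noteq> []" using 1(1) n_pos by (auto simp: is_qpoly_def)
    then have "R P' = (map ((*) c) (fst (R P)), c * snd (R P))"
      unfolding 1(2) 2(2) c(2,3) by (simp add: map_butlast last_map)
    then show ?thesis using R P P'T c(1) unfolding is_representation_def by blast
  qed
  with P'T show "P' \<in> {P' \<in> trace_zero n a d. R P' = R P}" by simp
qed

end

theorem mainTheorem2:
  fixes a d :: "'q::{field,finite}" and n :: nat
    and R :: "'q alg_closure point \<Rightarrow> 'q list \<times> 'q"
    and P :: "'q alg_closure point" and \<alpha> :: "'q list" and b :: 'q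
  assumes "odd CHAR('q)"
    and "prime n" and "odd n"
    and "a \<noteq> 0" and "d \<noteq> 0" and "a \<noteq> d"
    and "is_representation n a d R"
    and "P \<in> trace_zero n a d"
    and "R P = (\<alpha>, b)"
  shows "{P' \<in> trace_zero n a d. R P' = (\<alpha>, b)} = {(frob ^^ i) P | i. i < n} \<and>
    (\<forall>v. poly (map_poly to_ac (dec_Q n a d \<alpha> b)) v = 0 \<longrightarrow>
      (v \<noteq> 1 \<longrightarrow> poly (map_poly to_ac (dec_q2 n \<alpha> b)) v \<noteq> 0) \<and>
      (let u = (if v = 1 then 0
                else - (poly (map_poly to_ac (dec_q1 n \<alpha>)) v * (v + 1)
                        / poly (map_poly to_ac (dec_q2 n \<alpha> b)) v))
       in (Fin u, Fin v) \<in> {(frob ^^ i) P | i. i < n}))"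
proof -
  interpret edwards_over_finite_field a d n using assms by unfold_locales
  obtain as bs where q: "is_qpoly n a d P as bs" "\<alpha> = as @ butlast bs" "b = last bs"
    "length as = (n - 1) div 2" "length bs = Suc ((n - 1) div 2)"
    using representationE[OF assms(7-9)] .
  have "bs \<noteq> []" using q(5) by auto
  then have dec: "dec_q1 n \<alpha> = Poly as" "dec_q2 n \<alpha> b = Poly bs"
    by (simp_all add: dec_q1_def dec_q2_def q(2-4))
  \<comment> \<open>Identifies the decompression polynomial with the norm, so that its roots are
    governed by \<open>norm_root_orbit\<close>.\<close>
  have "map_poly to_ac (dec_Q n a d \<alpha> b) = norm_qpoly as bs"
    unfolding dec_Q_def dec norm_qpoly_def map_poly_to_ac_add map_poly_to_ac_mult map_poly_to_ac_power
    by simp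
  then show ?thesis
    using representation_fibre[OF assms(2,7,8)] norm_root_coeff_x_nonzero[OF assms(8) q(1)] norm_root_orbit[OF assms(8) q(1)]
    unfolding dec assms(9) frob_orbit_def[symmetric] Let_def by simp
qed

end
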